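(* Let $\mathbb{F}$ be a field of characteristic zero, let $\mathfrak{g}$ be a Lie algebra over $\mathbb{F}$ with a vector space decomposition $\mathfrak{g}=\mathfrak{g}^-\oplus\mathfrak{g}^+$, let $s,t$ be commuting formal variables commuting with $\mathfrak{g}$, and let $\pi^\pm:\mathfrak{g}[[s,t]]\to\mathfrak{g}^\pm[[s,t]]$ be the corresponding projections. There exists a unique bijection $$\Psi: t\mathfrak{g}^+[[s,t]]\times s\mathfrak{g}^-[[s,t]]\longrightarrow s\mathfrak{g}^-[[s,t]]\times t\mathfrak{g}^+[[s,t]]$$ such that for $g^\pm\in\mathfrak{g}^\pm[[s,t]]$, $$e^{tg^+}e^{sg^-}=e^{s\Psi^-}e^{t\Psi^+},$$ where $s\Psi^-=\pi^-\circ\Psi(tg^+,sg^-)$ and $t\Psi^+=\pi^+\circ\Psi(tg^+,sg^-)$. Moreover, the lowest order terms of $\Psi^\pm$ are described by $$\Psi^-=g^-+t\,\pi^-([g^+,g^-])+t\,\mathcal{P}^-(s,t),$$ $$\Psi^+=g^++s\,\pi^+([g^+,g^-])+s\,\mathcal{P}^+(s,t),$$ where $\mathcal{P}^\pm(s,t)\in\mathfrak{g}^\pm[[s,t]]$ and $\mathcal{P}^\pm(0,0)=0$.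
   Context: $\mathfrak{g}[[s,t]]$ is the Lie algebra of formal power series in $s,t$ with coefficients in $\mathfrak{g}$ (bracket extended $\mathbb{F}[[s,t]]$-bilinearly). The exponentials are elements of $U(\mathfrak{g})[[s,t]]$, where $U(\mathfrak{g})$ is the universal enveloping algebra. In the expressions $\pi^\pm\circ\Psi(tg^+,sg^-)$ the cartesian product $s\mathfrak{g}^-[[s,t]]\times t\mathfrak{g}^+[[s,t]]$ is identified with the direct sum $s\mathfrak{g}^-[[s,t]]\oplus t\mathfrak{g}^+[[s,t]]\subset\mathfrak{g}[[s,t]]$, so that $s\Psi^-$ and $t\Psi^+$ (with $\Psi^\pm\in\mathfrak{g}^\pm[[s,t]]$) are simply the two components of $\Psi(tg^+,sg^-)$. *)

theory Defs
  imports
    "HOL-Library.Poly_Mapping"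
    "HOL-Library.Function_Algebras"
    "HOL-Algebra.Algebraic_Closure_Type"
begin

section \<open>Lie algebras with a vector space decomposition\<close>

locale lie_algebra = vector_space scale
  for scale :: "'k::field \<Rightarrow> 'g::ab_group_add \<Rightarrow> 'g" +
  fixes bracket :: "'g \<Rightarrow> 'g \<Rightarrow> 'g"
  assumes bracket_linear_left: "Vector_Spaces.linear scale scale (\<lambda>x. bracket x y)"
    and bracket_linear_right: "Vector_Spaces.linear scale scale (\<lambda>y. bracket x y)"
    and bracket_alternating: "bracket x x = 0"
    and jacobi: "bracket x (bracket y z) + bracket y (bracket z x) + bracket z (bracket x y) = 0"

text \<open>The summands are only required to be vector subspaces, not Lie subalgebras.\<close>

locale split_lie_algebra = lie_algebra scale bracket
  for scale :: "'k::field \<Rightarrow> 'g::ab_group_add \<Rightarrow> 'g"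
    and bracket :: "'g \<Rightarrow> 'g \<Rightarrow> 'g" +
  fixes gm gp :: "'g set"
  assumes subspace_minus: "module.subspace scale gm"
    and subspace_plus: "module.subspace scale gp"
    and decomp_inter: "gm \<inter> gp = {0}"
    and decomp_sum: "\<exists>v\<in>gm. \<exists>w\<in>gp. x = v + w"

text \<open>The projection onto \<open>V\<close> along \<open>W\<close>.\<close>

definition proj_along :: "'g set \<Rightarrow> 'g set \<Rightarrow> 'g \<Rightarrow> 'g::ab_group_add" where
  "proj_along V W x = (THE v. v \<in> V \<and> (\<exists>w\<in>W. x = v + w))"

section \<open>The universal enveloping algebra\<close>

text \<open>Words form the free monoid, written additively because the convolution product of
  \<^typ>\<open>'m \<Rightarrow>\<^sub>0 'k\<close> is the multiplication of the monoid algebra of an additive monoid.\<close>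

datatype 'a free_word = Free_Word (letters: "'a list")

instantiation free_word :: (type) monoid_add
begin

definition zero_free_word :: "'a free_word" where
  "zero_free_word = Free_Word []"

definition plus_free_word :: "'a free_word \<Rightarrow> 'a free_word \<Rightarrow> 'a free_word" where
  "plus_free_word u v = Free_Word (letters u @ letters v)"

instance
  by standard (auto simp: zero_free_word_def plus_free_word_def)

end

text \<open>The free associative unital algebra on the underlying set of \<open>'g\<close>.\<close>

type_synonym ('k, 'g) free_alg = "'g free_word \<Rightarrow>\<^sub>0 'k"

definition gen :: "'g \<Rightarrow> ('k::field, 'g) free_alg" where
  "gen x = Poly_Mapping.single (Free_Word [x]) 1"

definition const :: "'k \<Rightarrow> ('k::field, 'g) free_alg" where
  "const c = Poly_Mapping.single (Free_Word []) c"

text \<open>The first two families of relations turn the free algebra into the tensor algebra of the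
  vector space, the third one turns the tensor algebra into the universal enveloping algebra.\<close>

definition envelope_rels ::
    "('k::field \<Rightarrow> 'g \<Rightarrow> 'g::ab_group_add) \<Rightarrow> ('g \<Rightarrow> 'g \<Rightarrow> 'g) \<Rightarrow> ('k, 'g) free_alg set" where
  "envelope_rels scale bracket =
     {gen (x + y) - gen x - gen y | x y. True} \<union>
     {gen (scale c x) - const c * gen x | c x. True} \<union>
     {gen x * gen y - gen y * gen x - gen (bracket x y) | x y. True}"

definition envelope_ideal ::
    "('k::field \<Rightarrow> 'g \<Rightarrow> 'g::ab_group_add) \<Rightarrow> ('g \<Rightarrow> 'g \<Rightarrow> 'g) \<Rightarrow> ('k, 'g) free_alg set" where
  "envelope_ideal scale bracket =
     genideal (ring_of_type_algebra :: ('k, 'g) free_alg ring) (envelope_rels scale bracket)"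

definition envelope ::
    "('k::field \<Rightarrow> 'g \<Rightarrow> 'g::ab_group_add) \<Rightarrow> ('g \<Rightarrow> 'g \<Rightarrow> 'g) \<Rightarrow> ('k, 'g) free_alg set ring" where
  "envelope scale bracket = ring_of_type_algebra Quot envelope_ideal scale bracket"

definition envelope_class ::
    "('k::field \<Rightarrow> 'g \<Rightarrow> 'g::ab_group_add) \<Rightarrow> ('g \<Rightarrow> 'g \<Rightarrow> 'g) \<Rightarrow>
     ('k, 'g) free_alg \<Rightarrow> ('k, 'g) free_alg set" where
  "envelope_class scale bracket a = envelope_ideal scale bracket +>\<^bsub>ring_of_type_algebra\<^esub> a"

lemma ring_free_alg: "ring (ring_of_type_algebra :: ('k::field, 'g) free_alg ring)"
proof -
  have "\<exists>y. x + y = 0" for x :: "('k, 'g) free_alg"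
    using add.right_inverse by blast
  then show ?thesis
    unfolding ring_of_type_algebra_def using add.right_inverse
    by unfold_locales (auto simp: algebra_simps Units_def)
qed

lemma ideal_envelope_ideal:
  "ideal (envelope_ideal scale bracket) (ring_of_type_algebra :: ('k::field, 'g::ab_group_add) free_alg ring)"
  unfolding envelope_ideal_def
  by (rule ring.genideal_ideal[OF ring_free_alg]) (simp add: ring_of_type_algebra_def)

lemma ring_envelope: "ring (envelope scale bracket)"
  unfolding envelope_def by (rule ideal.quotient_is_ring[OF ideal_envelope_ideal])

lemma envelope_class_hom:
  "envelope_class scale bracket \<in> ring_hom ring_of_type_algebra (envelope scale bracket)"
proof -
  have "envelope_class scale bracket = (+>\<^bsub>ring_of_type_algebra\<^esub>) (envelope_ideal scale bracket)"
    by (rule ext) (simp add: envelope_class_def)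
  then show ?thesis
    unfolding envelope_def by (metis ideal.rcos_ring_hom[OF ideal_envelope_ideal])
qed

section \<open>Formal power series in two commuting variables\<close>

text \<open>A series is its family of coefficients; the first index is the exponent of \<open>s\<close>,
  the second index is the exponent of \<open>t\<close>. Addition is that of
  \<^theory>\<open>HOL-Library.Function_Algebras\<close>; the pointwise product defined there plays no role.\<close>

type_synonym 'a ser = "nat \<Rightarrow> nat \<Rightarrow> 'a"

definition series :: "'a set \<Rightarrow> 'a ser set" where
  "series V = {f. \<forall>i j. f i j \<in> V}"

definition mul_s :: "'a::zero ser \<Rightarrow> 'a ser" where
  "mul_s f = (\<lambda>i j. case i of 0 \<Rightarrow> 0 | Suc i' \<Rightarrow> f i' j)"

definition mul_t :: "'a::zero ser \<Rightarrow> 'a ser" where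
  "mul_t f = (\<lambda>i j. case j of 0 \<Rightarrow> 0 | Suc j' \<Rightarrow> f i j')"

definition map_series :: "('a \<Rightarrow> 'b) \<Rightarrow> 'a ser \<Rightarrow> 'b ser" where
  "map_series h f = (\<lambda>i j. h (f i j))"

definition series_bracket ::
    "('g \<Rightarrow> 'g \<Rightarrow> 'g) \<Rightarrow> 'g ser \<Rightarrow> 'g ser \<Rightarrow> 'g::comm_monoid_add ser" where
  "series_bracket bracket f g =
     (\<lambda>i j. \<Sum>a\<le>i. \<Sum>b\<le>j. bracket (f a b) (g (i - a) (j - b)))"

text \<open>The ring \<open>R[[s,t]]\<close> over a possibly noncommutative ring \<open>R\<close>.\<close>

definition series_ring :: "('a, 'b) ring_scheme \<Rightarrow> 'a ser ring" where
  "series_ring R =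
     \<lparr>carrier = series (carrier R),
      monoid.mult = (\<lambda>f g i j. \<Oplus>\<^bsub>R\<^esub>a\<in>{..i}. \<Oplus>\<^bsub>R\<^esub>b\<in>{..j}. f a b \<otimes>\<^bsub>R\<^esub> g (i - a) (j - b)),
      monoid.one = (\<lambda>i j. if i = 0 \<and> j = 0 then \<one>\<^bsub>R\<^esub> else \<zero>\<^bsub>R\<^esub>),
      ring.zero = (\<lambda>i j. \<zero>\<^bsub>R\<^esub>),
      ring.add = (\<lambda>f g i j. f i j \<oplus>\<^bsub>R\<^esub> g i j)\<rparr>"

lemma series_ring_pow_vanishes:
  assumes "ring R" and f: "f \<in> carrier (series_ring R)" and f0: "f 0 0 = \<zero>\<^bsub>R\<^esub>"
  shows "f [^]\<^bsub>series_ring R\<^esub> (n::nat) \<in> carrier (series_ring R)"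
    and "i + j < n \<Longrightarrow> (f [^]\<^bsub>series_ring R\<^esub> n) i j = \<zero>\<^bsub>R\<^esub>"
proof -
  interpret ring R by fact
  have fc: "f a b \<in> carrier R" for a b
    using f by (simp add: series_ring_def series_def)
  have *: "f [^]\<^bsub>series_ring R\<^esub> n \<in> carrier (series_ring R) \<and>
      (\<forall>i j. i + j < n \<longrightarrow> (f [^]\<^bsub>series_ring R\<^esub> n) i j = \<zero>\<^bsub>R\<^esub>)"
  proof (induction n)
    case 0
    then show ?case by (simp add: series_ring_def series_def nat_pow_def)
  next
    case (Suc n)
    define p where "p = f [^]\<^bsub>series_ring R\<^esub> n"
    have pc: "p a b \<in> carrier R" for a b
      using Suc by (simp add: p_def series_ring_def series_def)
    have p0: "p a b = \<zero>\<^bsub>R\<^esub>" if "a + b < n" for a b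
      using Suc that by (simp add: p_def)
    have eq: "(f [^]\<^bsub>series_ring R\<^esub> Suc n) i j =
        (\<Oplus>\<^bsub>R\<^esub>a\<in>{..i}. \<Oplus>\<^bsub>R\<^esub>b\<in>{..j}. p a b \<otimes>\<^bsub>R\<^esub> f (i - a) (j - b))" for i j
      by (simp add: p_def series_ring_def nat_pow_def)
    have term0: "p a b \<otimes>\<^bsub>R\<^esub> f (i - a) (j - b) = \<zero>\<^bsub>R\<^esub>"
      if "i + j < Suc n" "a \<le> i" "b \<le> j" for i j a b
    proof (cases "a = i \<and> b = j")
      case True
      then show ?thesis using f0 pc by simp
    next
      case False
      then have "a + b < n" using that by auto
      then show ?thesis using p0 fc by simp
    qed
    have "(f [^]\<^bsub>series_ring R\<^esub> Suc n) i j = \<zero>\<^bsub>R\<^esub>" if "i + j < Suc n" for i j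
    proof -
      have "(\<Oplus>\<^bsub>R\<^esub>b\<in>{..j}. p a b \<otimes>\<^bsub>R\<^esub> f (i - a) (j - b)) = \<zero>\<^bsub>R\<^esub>" if "a \<le> i" for a
        by (rule add.finprod_one_eqI) (use term0 that \<open>i + j < Suc n\<close> in auto)
      then show ?thesis
        unfolding eq by (rule add.finprod_one_eqI) auto
    qed
    moreover have "f [^]\<^bsub>series_ring R\<^esub> Suc n \<in> carrier (series_ring R)"
    proof -
      have "(f [^]\<^bsub>series_ring R\<^esub> Suc n) i j \<in> carrier R" for i j
        unfolding eq using pc fc by (auto intro!: finsum_closed)
      then show ?thesis
        by (simp add: series_ring_def series_def)
    qed
    ultimately show ?case by blast
  qed
  then show "f [^]\<^bsub>series_ring R\<^esub> (n::nat) \<in> carrier (series_ring R)"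
    and "i + j < n \<Longrightarrow> (f [^]\<^bsub>series_ring R\<^esub> n) i j = \<zero>\<^bsub>R\<^esub>" by blast+
qed

section \<open>Exponentials and the factorization\<close>

text \<open>The exponential in \<open>U(\<gg>)[[s,t]]\<close> of the image of a series \<open>f\<close> in \<open>\<gg>[[s,t]]\<close>
  without constant term. Its \<open>n\<close>-th power has no coefficients of total degree below \<open>n\<close>
  (lemma \<open>series_ring_pow_vanishes\<close>), so the exponential series is a finite sum in each coefficient.\<close>

definition series_exp ::
    "('k::field_char_0 \<Rightarrow> 'g \<Rightarrow> 'g::ab_group_add) \<Rightarrow> ('g \<Rightarrow> 'g \<Rightarrow> 'g) \<Rightarrow>
     'g ser \<Rightarrow> ('k, 'g) free_alg set ser" where
  "series_exp scale bracket f = (let U = envelope scale bracket; cl = envelope_class scale bracket in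
     (\<lambda>i j. \<Oplus>\<^bsub>U\<^esub>n\<in>{..i + j}. cl (const (1 / fact n)) \<otimes>\<^bsub>U\<^esub>
        ((map_series (\<lambda>x. cl (gen x)) f [^]\<^bsub>series_ring U\<^esub> n) i j)))"

text \<open>The maps \<open>\<pi>\<^sup>-\<close> and \<open>\<pi>\<^sup>+\<close> applied to a pair in
  \<open>s\<gg>\<^sup>-[[s,t]] \<times> t\<gg>\<^sup>+[[s,t]]\<close>, which is identified with the sum of its
  components in \<open>\<gg>[[s,t]]\<close>.\<close>

definition pi_minus :: "'g set \<Rightarrow> 'g set \<Rightarrow> 'g::ab_group_add ser \<Rightarrow> 'g ser" where
  "pi_minus gm gp = map_series (proj_along gm gp)"

definition pi_plus :: "'g set \<Rightarrow> 'g set \<Rightarrow> 'g::ab_group_add ser \<Rightarrow> 'g ser" where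
  "pi_plus gm gp = map_series (proj_along gp gm)"

definition pair_sum :: "'g ser \<times> 'g ser \<Rightarrow> 'g::ab_group_add ser" where
  "pair_sum z = fst z + snd z"

text \<open>A map defined on a set \<open>D\<close> is represented by its extensional version, so that
  uniqueness of functions means uniqueness of their values on \<open>D\<close>.\<close>

definition is_factorization_bijection ::
    "('k::field_char_0 \<Rightarrow> 'g \<Rightarrow> 'g::ab_group_add) \<Rightarrow> ('g \<Rightarrow> 'g \<Rightarrow> 'g) \<Rightarrow> 'g set \<Rightarrow> 'g set \<Rightarrow>
     ('g ser \<times> 'g ser \<Rightarrow> 'g ser \<times> 'g ser) \<Rightarrow> bool" where
  "is_factorization_bijection scale bracket gm gp \<Psi> \<longleftrightarrow>
     \<Psi> \<in> extensional (mul_t ` series gp \<times> mul_s ` series gm) \<and>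
     bij_betw \<Psi> (mul_t ` series gp \<times> mul_s ` series gm) (mul_s ` series gm \<times> mul_t ` series gp) \<and>
     (\<forall>f\<in>series gp. \<forall>h\<in>series gm.
        series_exp scale bracket (mul_t f)
            \<otimes>\<^bsub>series_ring (envelope scale bracket)\<^esub> series_exp scale bracket (mul_s h) =
        series_exp scale bracket (pi_minus gm gp (pair_sum (\<Psi> (mul_t f, mul_s h))))
            \<otimes>\<^bsub>series_ring (envelope scale bracket)\<^esub>
          series_exp scale bracket (pi_plus gm gp (pair_sum (\<Psi> (mul_t f, mul_s h)))))"

end

theory Submission
  imports Defs "HOL-Computational_Algebra.Formal_Power_Series"
begin

text \<open>
  Write \<open>D\<close> for the Euler derivation of \<open>U(\<gg>)[[s,t]]\<close>, which multiplies the coefficient of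
  \<open>s\<^sup>i t\<^sup>j\<close> by \<open>i + j\<close>. A product \<open>A\<close> of exponentials of series in \<open>\<gg>[[s,t]]\<close> satisfies
  \<open>D A = A \<omega>\<close> with \<open>\<omega>\<close> in \<open>\<gg>[[s,t]]\<close>, because conjugation by an exponential preserves
  \<open>\<gg>[[s,t]]\<close>. Hence if two such products \<open>A\<close> and \<open>B\<close> agree below total degree \<open>n > 0\<close>, then \<open>n\<close>
  times the degree \<open>n\<close> part of \<open>A - B\<close> is that of the difference of the two logarithmic derivatives and
  so lies in \<open>\<gg>\<close>. Splitting it along \<open>\<gg>\<^sup>- \<oplus> \<gg>\<^sup>+\<close> corrects the factors in degree \<open>n\<close>, and
  refactorization in either order is constructed degree by degree.

  Uniqueness needs that \<open>\<gg>\<close> embeds into \<open>U(\<gg>)\<close>. For this, the part of degree one of the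
  Poincare-Birkhoff-Witt normal form is constructed as a linear map from the free algebra to \<open>\<gg>\<close>
  that annihilates the defining relations and sends every generator to itself.
\<close>

section \<open>The Lie algebra embeds into its enveloping algebra\<close>

text \<open>As the summands are only subspaces, their exponentials do not generate complementary
  groups in any evident way, and the factors are found by solving a linear problem in each degree.
  That problem is to split an element of the Lie algebra, which is possible only at positions with
  both exponents positive: where the exponent of \<open>s\<close> or of \<open>t\<close> is 0, one
  of the two coefficient spaces is 0. There the factorization holds for another reason: one of the
  two exponentials is 1 along the whole axis, so the factors commute and are kept unchanged.

  The Euler derivation multiplies degree n by n, which is invertible for n > 0 in characteristic 0;
  so one derivation serves both variables.

  The enveloping algebra is a set of cosets and not a type. All series are therefore computed over
  the free algebra, and equalities in the quotient become congruences of coefficients modulo the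
  ideal.\<close>

lemma additive_eq_0_free_alg:
  fixes \<phi> :: "('a \<Rightarrow>\<^sub>0 'b::monoid_add) \<Rightarrow> 'c::ab_group_add"
  assumes add: "\<And>a b. \<phi> (a + b) = \<phi> a + \<phi> b"
    and single: "\<And>w c. \<phi> (Poly_Mapping.single w c) = 0"
  shows "\<phi> a = 0"
proof (induction a rule: update_induct)
  case const
  then show ?case using single[of undefined 0] by simp
next
  case (update f a b)
  have "Poly_Mapping.update a b f = f + Poly_Mapping.single a b"
    using update by (intro poly_mapping_eqI) (auto simp: lookup_update lookup_add lookup_single in_keys_iff when_def)
  then show ?case using update by (simp add: add single)
qed

text \<open>Second component of the termination measure of \<open>rho\<close>: straightening a
  descent yields words that are shorter, or equally long with fewer pairs out of order.\<close>

fun inversions :: "('a \<Rightarrow> 'a \<Rightarrow> bool) \<Rightarrow> 'a list \<Rightarrow> nat" where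
  "inversions lt [] = 0"
| "inversions lt (x # xs) = length (filter (\<lambda>y. lt y x) xs) + inversions lt xs"

lemma inversions_swap:
  assumes "lt y x" "\<not> lt x y"
  shows "inversions lt (u @ y # x # v) < inversions lt (u @ x # y # v)"
  using assms by (induction u) auto

context lie_algebra
begin

lemmas bracket_add_left = bracket_linear_left[THEN Vector_Spaces.linear.axioms(3), THEN module_hom.add]
  and bracket_add_right = bracket_linear_right[THEN Vector_Spaces.linear.axioms(3), THEN module_hom.add]
  and bracket_scale_left = bracket_linear_left[THEN Vector_Spaces.linear.axioms(3), THEN module_hom.scale]
  and bracket_scale_right = bracket_linear_right[THEN Vector_Spaces.linear.axioms(3), THEN module_hom.scale]
  and bracket_neg_right = bracket_linear_right[THEN Vector_Spaces.linear.axioms(3), THEN module_hom.neg]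

lemma bracket_antisym: "bracket x y = - bracket y x"
proof -
  have "bracket (x + y) (x + y) = bracket x x + bracket y x + (bracket x y + bracket y y)"
    by (simp only: bracket_add_left bracket_add_right)
  then have "bracket y x + bracket x y = 0"
    by (simp only: bracket_alternating) simp
  then show ?thesis by (simp only: eq_neg_iff_add_eq_0 add.commute)
qed

end

section \<open>Straightening of words over an ordered basis\<close>

locale lie_algebra_ordered_basis = lie_algebra scale bracket
  for scale :: "'k::field \<Rightarrow> 'g::ab_group_add \<Rightarrow> 'g" and bracket :: "'g \<Rightarrow> 'g \<Rightarrow> 'g" +
  fixes B :: "'g set" and lt :: "'g \<Rightarrow> 'g \<Rightarrow> bool"
  assumes indep: "independent B" and span_B: "span B = UNIV"
    and lt_irrefl: "\<not> lt x x" and lt_trans: "lt x y \<Longrightarrow> lt y z \<Longrightarrow> lt x z"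
    and lt_total: "x \<noteq> y \<Longrightarrow> lt x y \<or> lt y x"
begin

lemma lt_asym: "lt x y \<Longrightarrow> \<not> lt y x"
  using lt_irrefl lt_trans by blast

text \<open>The linear extension of \<open>f\<close> from \<open>B\<close>. Only values of
  \<open>f\<close> on basis elements enter, so \<open>ext_cong\<close> can serve as congruence rule
  for the recursive calls of \<open>rho\<close> under \<open>ext\<close>.\<close>

definition ext :: "('g \<Rightarrow> 'g) \<Rightarrow> 'g \<Rightarrow> 'g" where
  "ext f v = (\<Sum>b | representation B v b \<noteq> 0. scale (representation B v b) (f b))"

lemma ext_cong [fundef_cong]:
  assumes "v = v'" "\<And>b. b \<in> B \<Longrightarrow> f b = g b"
  shows "ext f v = ext g v'"
  unfolding ext_def assms(1) by (intro sum.cong refl) (auto simp: assms(2) dest: representation_ne_zero)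

lemma ext_superset:
  assumes "finite S" "{b. representation B v b \<noteq> 0} \<subseteq> S"
  shows "ext f v = (\<Sum>b\<in>S. scale (representation B v b) (f b))"
  unfolding ext_def by (rule sum.mono_neutral_left) (use assms in auto)

lemma linear_ext: "Vector_Spaces.linear scale scale (ext f)"
proof (rule iffD1[OF module_hom_iff_linear], unfold_locales)
  fix v w c
  let ?S = "{b. representation B v b \<noteq> 0} \<union> {b. representation B w b \<noteq> 0}"
  have S: "finite ?S" using finite_representation by auto
  have add: "representation B (v + w) b = representation B v b + representation B w b" for b
    using representation_add[OF indep] span_B by auto
  show "ext f (v + w) = ext f v + ext f w"
    by (subst (1 2 3) ext_superset[OF S])
      (auto simp: add scale_left_distrib sum.distrib)
  have scl: "representation B (scale c v) b = c * representation B v b" for b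
    using representation_scale[OF indep] span_B by auto
  show "ext f (scale c v) = scale c (ext f v)"
    by (subst (1 2) ext_superset[OF S])
      (auto simp: scl scale_sum_right)
qed

lemma ext_basis: "b \<in> B \<Longrightarrow> ext f b = f b"
  by (simp add: ext_def representation_basis[OF indep] if_distrib cong: if_cong)

lemma linear_eq_on_B:
  assumes "Vector_Spaces.linear scale scale f" "Vector_Spaces.linear scale scale g"
    and "\<And>b. b \<in> B \<Longrightarrow> f b = g b"
  shows "f x = g x"
proof -
  interpret vector_space_pair scale scale by unfold_locales
  show ?thesis using linear_eq_on[OF assms(1,2), of x B] assms(3) span_B by auto
qed

lemma ext_fun_add: "ext (\<lambda>b. f b + g b) v = ext f v + ext g v"
  by (simp add: ext_def scale_right_distrib sum.distrib)

lemma ext_fun_diff: "ext (\<lambda>b. f b - g b) v = ext f v - ext g v"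
  by (simp add: ext_def scale_right_diff_distrib sum_subtractf)

lemma ext_fun_scale: "ext (\<lambda>b. scale c (f b)) v = scale c (ext f v)"
  by (simp add: ext_def scale_sum_right mult.commute)

text \<open>Needed when two disjoint descents are straightened: their brackets are expanded in the
  basis in either order.\<close>

lemma ext_swap: "ext (\<lambda>b. ext (f b) q) p = ext (\<lambda>c. ext (\<lambda>b. f b c) p) q"
  unfolding ext_def scale_sum_right
  by (subst sum.swap) (simp add: mult.commute)

lemmas ext_add = linear_ext[THEN Vector_Spaces.linear.axioms(3), THEN module_hom.add]
  and ext_scale = linear_ext[THEN Vector_Spaces.linear.axioms(3), THEN module_hom.scale]
  and ext_diff = linear_ext[THEN Vector_Spaces.linear.axioms(3), THEN module_hom.diff]
  and ext_neg = linear_ext[THEN Vector_Spaces.linear.axioms(3), THEN module_hom.neg]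
  and ext_zero = linear_ext[THEN Vector_Spaces.linear.axioms(3), THEN module_hom.zero]

text \<open>The part of degree one of the normal form of a word in basis elements, computed by straightening an
  arbitrarily chosen descent. Lemma \<open>rho_descent\<close> shows that the choice does not matter.\<close>

function rho :: "'g list \<Rightarrow> 'g" where
  "rho w = (if \<exists>u x y v. w = u @ x # y # v \<and> lt y x
     then case (SOME (u, x, y, v). w = u @ x # y # v \<and> lt y x) of (u, x, y, v) \<Rightarrow>
       rho (u @ y # x # v) + ext (\<lambda>b. rho (u @ b # v)) (bracket x y)
     else if length w = 1 then hd w else 0)"
  by auto
termination
proof (relation "measures [length, inversions lt]", simp, goal_cases)
  case (1 w u p x q y v)
  then have "case (u, x, y, v) of (u, x, y, v) \<Rightarrow> w = u @ x # y # v \<and> lt y x"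
    by (metis (mono_tags, lifting) case_prod_conv someI_ex)
  then show ?case using inversions_swap[of lt y x] lt_asym by auto
next
  case (2 w u p x q y v b)
  then have "case (u, x, y, v) of (u, x, y, v) \<Rightarrow> w = u @ x # y # v \<and> lt y x"
    by (metis (mono_tags, lifting) case_prod_conv someI_ex)
  then show ?case by auto
qed

declare rho.simps [simp del]

lemma rho_sorted: "(\<And>u x y v. w = u @ x # y # v \<Longrightarrow> \<not> lt y x) \<Longrightarrow> rho w = (if length w = 1 then hd w else 0)"
  by (subst rho.simps) auto

abbreviation contract :: "'g list \<Rightarrow> 'g \<Rightarrow> 'g list \<Rightarrow> 'g" where
  "contract u p v \<equiv> ext (\<lambda>b. rho (u @ b # v)) p"

lemma rho_some_descent:
  assumes "w = u @ x # y # v" "lt y x"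
  obtains u' x' y' v' where "w = u' @ x' # y' # v'" "lt y' x'"
    "rho w = rho (u' @ y' # x' # v') + contract u' (bracket x' y') v'"
proof -
  let ?P = "\<lambda>(u, x, y, v). w = u @ x # y # v \<and> lt y x"
  obtain u' x' y' v' where e: "(SOME z. ?P z) = (u', x', y', v')" by (rule prod_cases4)
  have ex: "(\<exists>u x y v. w = u @ x # y # v \<and> lt y x) = True" using assms by blast
  have "?P (u, x, y, v)" using assms by simp
  then have "?P (SOME z. ?P z)" by (rule someI)
  then have "w = u' @ x' # y' # v'" "lt y' x'" unfolding e by simp_all
  moreover have "rho w = rho (u' @ y' # x' # v') + contract u' (bracket x' y') v'"
    unfolding rho.simps[of w] ex if_True e by simp
  ultimately show ?thesis by (rule that)
qed

text \<open>These are the critical pairs of the straightening: the descents overlap in one letter,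
  or they are disjoint.\<close>

lemma two_descents_cases:
  assumes "u @ x # y # v = u' @ x' # y' # v'" "length u < length u'"
  obtains "u' = u @ [x]" "y = x'" "v = y' # v'"
    | m where "u' = u @ x # y # m" "v = m @ x' # y' # v'"
proof -
  from assms obtain r where r: "u' = u @ r" "x # y # v = r @ x' # y' # v'"
    by (force simp: append_eq_append_conv2)
  with assms(2) obtain r' where "r = x # r'" by (cases r) auto
  then show ?thesis using r that by (cases r') auto
qed

lemma linear_bracket_ext:
  "Vector_Spaces.linear scale scale (\<lambda>p. ext f (bracket p q))"
  by (rule iffD1[OF module_hom_iff_linear], unfold_locales)
    (simp_all add: bracket_add_left bracket_scale_left ext_add ext_scale)

text \<open>A diamond lemma argument by induction on length and then inversions. The descent chosen
  by \<open>rho\<close> and the given one lead to the same value: for overlapping descents this is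
  the Jacobi identity, for disjoint ones it is \<open>ext_swap\<close>.\<close>

lemma rho_descent:
  assumes "set (u @ x # y # v) \<subseteq> B" "lt y x"
  shows "rho (u @ x # y # v) = rho (u @ y # x # v) + contract u (bracket x y) v"
  using assms
proof (induction "u @ x # y # v" arbitrary: u x y v rule: wf_induct_rule[OF wf_measures[of "[length, inversions lt]"]])
  case (1 u x y v)
  define w where "w = u @ x # y # v"
  have wB: "set w \<subseteq> B" using 1(2) by (simp add: w_def)
  have IH: "rho (p @ a # b # q) = rho (p @ b # a # q) + contract p (bracket a b) q"
    if "set (p @ a # b # q) \<subseteq> B" "lt b a"
      "length (p @ a # b # q) < length w \<or>
       length (p @ a # b # q) = length w \<and> inversions lt (p @ a # b # q) < inversions lt w" for p a b q
    using 1(1)[of p a b q] that by (auto simp: w_def)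
  \<comment> \<open>On words one letter shorter than \<open>w\<close> the induction hypothesis
    covers every adjacent pair of basis letters: ascents follow from descents by antisymmetry, and
    equal letters have bracket 0.\<close>
  have short: "rho (p @ a # b # q) - rho (p @ b # a # q) = contract p (bracket a b) q"
    if "set (p @ a # b # q) \<subseteq> B" "Suc (length (p @ a # b # q)) = length w" for p a b q
  proof (cases "a = b")
    case True
    then show ?thesis by (simp add: bracket_alternating ext_zero)
  next
    case False
    then consider "lt b a" | "lt a b" using lt_total by blast
    then show ?thesis
    proof cases
      case 1
      then show ?thesis using IH[of p a b q] that by simp
    next
      case 2
      have "contract p (bracket b a) q = - contract p (bracket a b) q"
        by (metis bracket_antisym ext_neg)
      with 2 show ?thesis using IH[of p b a q] that by simp
    qed
  qed
  \<comment> \<open>Linear extension of \<open>short\<close> in one letter, which may then itself be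
    a bracket; this is where nested brackets arise.\<close>
  have shortL: "ext (\<lambda>a. rho (p @ a # b # q)) c - ext (\<lambda>a. rho (p @ b # a # q)) c = contract p (bracket c b) q"
    if "set (p @ b # q) \<subseteq> B" "Suc (Suc (length (p @ b # q))) = length w" for p b q c
    unfolding ext_fun_diff[symmetric]
    by (rule linear_eq_on_B[OF linear_ext linear_bracket_ext]) (use that in \<open>simp add: ext_basis short\<close>)
  let ?R = "\<lambda>u x y v. rho (u @ y # x # v) + contract u (bracket x y) v"
  \<comment> \<open>Local confluence. It suffices to treat a descent that starts to the left of the
    other, since the roles are symmetric.\<close>
  have confl: "?R u x y v = ?R u' x' y' v'"
    if w: "w = u @ x # y # v" "w = u' @ x' # y' # v'" and lt: "lt y x" "lt y' x'"
      and len: "length u < length u'" for u x y v u' x' y' v'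
    using trans[OF w(1)[symmetric] w(2)] len
  proof (cases rule: two_descents_cases)
    case 1
    \<comment> \<open>The overlap is \<open>x # y # z\<close> with \<open>z\<close> below
      \<open>y\<close> below \<open>x\<close>. Both routes end in the reversed order
      \<open>z # y # x\<close>, and the brackets collected on the way differ by a Jacobi
      sum.\<close>
    define z where "z = y'"
    have e: "w = u @ x # y # z # v'" "u' = u @ [x]" "x' = y" "y' = z"
      using 1 w by (auto simp: z_def)
    have v: "v = z # v'" using 1 by (simp add: z_def)
    have zy: "lt z y" using lt e by simp
    have zx: "lt z x" using lt zy lt_trans by blast
    have B: "set u \<subseteq> B" "x \<in> B" "y \<in> B" "z \<in> B" "set v' \<subseteq> B" using wB e by auto
    have swap: "inversions lt (p @ b # a # q) < inversions lt (p @ a # b # q)" if "lt b a" for p a b q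
      using inversions_swap[of lt b a] that lt_asym by auto
    have i1: "inversions lt (u @ y # x # z # v') < inversions lt w"
      using swap[of y x u "z # v'"] lt e by simp
    have i2: "inversions lt (u @ y # z # x # v') < inversions lt w"
      using i1 swap[OF zx, of "u @ [y]" v'] by simp
    have i3: "inversions lt (u @ x # z # y # v') < inversions lt w"
      using swap[OF zy, of "u @ [x]" v'] e by simp
    have i4: "inversions lt (u @ z # x # y # v') < inversions lt w"
      using i3 swap[OF zx, of u "y # v'"] by simp
    have l1: "rho (u @ y # x # z # v') = rho (u @ y # z # x # v') + contract (u @ [y]) (bracket x z) v'"
      using IH[of "u @ [y]" x z v'] zx i1 B e by simp
    have l2: "rho (u @ y # z # x # v') = rho (u @ z # y # x # v') + contract u (bracket y z) (x # v')"
      using IH[of u y z "x # v'"] zy i2 B e by simp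
    have r1: "rho (u @ x # z # y # v') = rho (u @ z # x # y # v') + contract u (bracket x z) (y # v')"
      using IH[of u x z "y # v'"] zx i3 B e by simp
    have r2: "rho (u @ z # x # y # v') = rho (u @ z # y # x # v') + contract (u @ [z]) (bracket x y) v'"
      using IH[of "u @ [z]" x y v'] lt i4 B e by simp
    have s1: "contract u (bracket x y) (z # v') - contract (u @ [z]) (bracket x y) v'
        = contract u (bracket (bracket x y) z) v'"
      using shortL[of u z v' "bracket x y"] B e by simp
    have s2: "contract u (bracket x z) (y # v') - contract (u @ [y]) (bracket x z) v'
        = contract u (bracket (bracket x z) y) v'"
      using shortL[of u y v' "bracket x z"] B e by simp
    have s3: "contract u (bracket y z) (x # v') - contract (u @ [x]) (bracket y z) v'
        = contract u (bracket (bracket y z) x) v'"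
      using shortL[of u x v' "bracket y z"] B e by simp
    have e3: "bracket (bracket x z) y = bracket y (bracket z x)"
      using bracket_antisym[of "bracket x z" y] bracket_antisym[of x z] by (simp add: bracket_neg_right)
    have "bracket (bracket x y) z - bracket (bracket x z) y + bracket (bracket y z) x
        = - (bracket x (bracket y z) + bracket y (bracket z x) + bracket z (bracket x y))"
      unfolding e3 bracket_antisym[of "bracket x y" z] bracket_antisym[of "bracket y z" x] by simp
    then have jac: "bracket (bracket x y) z - bracket (bracket x z) y + bracket (bracket y z) x = 0"
      by (simp add: jacobi)
    have "contract u (bracket (bracket x y) z) v' - contract u (bracket (bracket x z) y) v'
      + contract u (bracket (bracket y z) x) v' = 0"
      by (simp only: ext_add[symmetric] ext_diff[symmetric] jac ext_zero)
    then show ?thesis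
      unfolding e(2-4) v using l1 l2 r1 r2 s1 s2 s3 by (simp add: algebra_simps)
  next
    case (2 m)
    have e: "w = u @ x # y # m @ x' # y' # v'" "u' = u @ x # y # m" "v = m @ x' # y' # v'"
      using 2 w by auto
    have B: "set u \<subseteq> B" "x \<in> B" "y \<in> B" "set m \<subseteq> B" "x' \<in> B" "y' \<in> B" "set v' \<subseteq> B" using wB e by auto
    have i1: "inversions lt (u @ y # x # m @ x' # y' # v') < inversions lt w"
      using inversions_swap[of lt y x u] lt lt_asym e by auto
    have i2: "inversions lt (u @ x # y # m @ y' # x' # v') < inversions lt w"
      using inversions_swap[of lt y' x' "u @ x # y # m"] lt lt_asym e by auto
    have l1: "rho (u @ y # x # m @ x' # y' # v') =
        rho (u @ y # x # m @ y' # x' # v') + contract (u @ y # x # m) (bracket x' y') v'"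
      using IH[of "u @ y # x # m" x' y' v'] i1 B e lt by simp
    have r1: "rho (u @ x # y # m @ y' # x' # v') =
        rho (u @ y # x # m @ y' # x' # v') + contract u (bracket x y) (m @ y' # x' # v')"
      using IH[of u x y "m @ y' # x' # v'"] i2 B e lt by simp
    \<comment> \<open>Under the bracket of \<open>x\<close> and \<open>y\<close> the other descent
      is still to be straightened. This leaves a term containing both brackets, which
      \<open>r2\<close> yields with the expansions in the opposite order.\<close>
    have l2: "contract u (bracket x y) (m @ x' # y' # v') =
        contract u (bracket x y) (m @ y' # x' # v') +
        ext (\<lambda>b. ext (\<lambda>c. rho (u @ b # m @ c # v')) (bracket x' y')) (bracket x y)"
      unfolding ext_fun_add[symmetric]
    proof (rule ext_cong[OF refl])
      fix b assume "b \<in> B"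
      then show "rho (u @ b # m @ x' # y' # v') = rho (u @ b # m @ y' # x' # v') +
          ext (\<lambda>c. rho (u @ b # m @ c # v')) (bracket x' y')"
        using IH[of "u @ b # m" x' y' v'] B e lt by simp
    qed
    have r2: "contract (u @ x # y # m) (bracket x' y') v' =
        contract (u @ y # x # m) (bracket x' y') v' +
        ext (\<lambda>c. ext (\<lambda>b. rho (u @ b # m @ c # v')) (bracket x y)) (bracket x' y')"
      unfolding ext_fun_add[symmetric]
    proof (rule ext_cong[OF refl])
      fix c assume "c \<in> B"
      then show "rho ((u @ x # y # m) @ c # v') = rho ((u @ y # x # m) @ c # v') +
          ext (\<lambda>b. rho (u @ b # m @ c # v')) (bracket x y)"
        using IH[of u x y "m @ c # v'"] B e lt by simp
    qed
    show ?thesis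
      using l1 l2 r1 r2 ext_swap[of "\<lambda>b c. rho (u @ b # m @ c # v')" "bracket x' y'" "bracket x y"] 
      by (simp add: e algebra_simps)
  qed
  obtain u' x' y' v' where s: "w = u' @ x' # y' # v'" "lt y' x'" "rho w = ?R u' x' y' v'"
    using rho_some_descent[OF w_def 1(3)] by blast
  have "?R u x y v = ?R u' x' y' v'"
  proof (cases "length u" "length u'" rule: linorder_cases)
    case less
    then show ?thesis using confl[OF w_def s(1) 1(3) s(2)] by simp
  next
    case equal
    then show ?thesis using s(1) by (simp add: w_def)
  next
    case greater
    then show ?thesis using confl[OF s(1) w_def s(2) 1(3)] by simp
  qed
  then show ?case using s(3) by (simp add: w_def)
qed

lemma rho_swap:
  assumes "set (p @ a # b # q) \<subseteq> B"
  shows "rho (p @ a # b # q) - rho (p @ b # a # q) = contract p (bracket a b) q"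
proof (cases "a = b")
  case True
  then show ?thesis by (simp add: bracket_alternating ext_zero)
next
  case False
  then consider "lt b a" | "lt a b" using lt_total by blast
  then show ?thesis
  proof cases
    case 1
    then show ?thesis using rho_descent[of p a b q] assms by simp
  next
    case 2
    have "contract p (bracket b a) q = - contract p (bracket a b) q"
      by (metis bracket_antisym ext_neg)
    with 2 show ?thesis using rho_descent[of p b a q] assms by simp
  qed
qed

text \<open>The multilinear extension of \<open>rho\<close> to words in arbitrary vectors;
  \<open>p\<close> collects the basis letters already substituted for the letters read so
  far.\<close>

fun rho_ext :: "'g list \<Rightarrow> 'g list \<Rightarrow> 'g" where
  "rho_ext p [] = rho p"
| "rho_ext p (x # xs) = ext (\<lambda>b. rho_ext (p @ [b]) xs) x"

lemma rho_ext_add: "rho_ext p (u @ (x + y) # v) = rho_ext p (u @ x # v) + rho_ext p (u @ y # v)"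
  by (induction u arbitrary: p) (simp_all add: ext_add ext_fun_add)

lemma rho_ext_scale: "rho_ext p (u @ scale c x # v) = scale c (rho_ext p (u @ x # v))"
  by (induction u arbitrary: p) (simp_all add: ext_scale ext_fun_scale)

lemma rho_ext_swap_basis:
  assumes "set (p @ a # b # q) \<subseteq> B"
  shows "rho_ext (p @ a # b # q) v - rho_ext (p @ b # a # q) v = ext (\<lambda>c. rho_ext (p @ c # q) v) (bracket a b)"
  using assms
proof (induction v arbitrary: q)
  case Nil
  then show ?case by (simp add: rho_swap)
next
  case (Cons x v)
  have "ext (\<lambda>d. rho_ext (p @ a # b # q @ [d]) v - rho_ext (p @ b # a # q @ [d]) v) x
      = ext (\<lambda>d. ext (\<lambda>c. rho_ext (p @ c # q @ [d]) v) (bracket a b)) x"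
    by (rule ext_cong[OF refl]) (use Cons in simp)
  then have "ext (\<lambda>d. rho_ext (p @ a # b # q @ [d]) v) x - ext (\<lambda>d. rho_ext (p @ b # a # q @ [d]) v) x
      = ext (\<lambda>c. ext (\<lambda>d. rho_ext (p @ c # q @ [d]) v) x) (bracket a b)"
    using ext_swap[of "\<lambda>d c. rho_ext (p @ c # q @ [d]) v" "bracket a b" x] by (simp add: ext_fun_diff)
  then show ?case by simp
qed

text \<open>For empty \<open>u\<close> both sides are bilinear in \<open>x\<close> and
  \<open>y\<close>, so basis letters suffice, where \<open>rho_ext_swap_basis\<close> applies. A
  letter in front is expanded in the basis and moved into \<open>p\<close>.\<close>

lemma rho_ext_swap:
  assumes "set p \<subseteq> B"
  shows "rho_ext p (u @ x # y # v) - rho_ext p (u @ y # x # v) = rho_ext p (u @ bracket x y # v)"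
  using assms
proof (induction u arbitrary: p)
  case Nil
  let ?f = "\<lambda>x y. rho_ext p (x # y # v) - rho_ext p (y # x # v)"
  have lin: "Vector_Spaces.linear scale scale (\<lambda>x. ?f x y)" "Vector_Spaces.linear scale scale (\<lambda>y. ?f x y)" for x y
    by (rule iffD1[OF module_hom_iff_linear], unfold_locales;
      simp add: ext_fun_add ext_fun_scale ext_add ext_scale scale_right_diff_distrib)+
  have lin': "Vector_Spaces.linear scale scale (\<lambda>x. rho_ext p (bracket x y # v))"
    "Vector_Spaces.linear scale scale (\<lambda>y. rho_ext p (bracket x y # v))" for x y
    by (rule iffD1[OF module_hom_iff_linear], unfold_locales;
      simp add: ext_add ext_scale bracket_add_left bracket_add_right bracket_scale_left bracket_scale_right)+
  have "?f a b = rho_ext p (bracket a b # v)" if "a \<in> B" "b \<in> B" for a b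
    using rho_ext_swap_basis[of p a b "[]" v] that Nil by (simp add: ext_basis)
  then have "?f a y = rho_ext p (bracket a y # v)" if "a \<in> B" for a
    using linear_eq_on_B[OF lin(2) lin'(2)] that by metis
  then have "?f x y = rho_ext p (bracket x y # v)"
    using linear_eq_on_B[OF lin(1) lin'(1)] by metis
  then show ?case by simp
next
  case (Cons z u)
  have "ext (\<lambda>b. rho_ext (p @ [b]) (u @ x # y # v) - rho_ext (p @ [b]) (u @ y # x # v)) z
      = ext (\<lambda>b. rho_ext (p @ [b]) (u @ bracket x y # v)) z"
    by (rule ext_cong[OF refl]) (use Cons in simp)
  then show ?case by (simp add: ext_fun_diff)
qed

lemma rho_ext_singleton: "rho_ext [] [x] = x"
proof -
  have "rho [b] = b" for b by (subst rho_sorted) auto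
  moreover have "ext (\<lambda>b. b) x = x"
    by (rule linear_eq_on_B[OF linear_ext linear_id[unfolded id_def]]) (simp add: ext_basis)
  ultimately show ?thesis by simp
qed

section \<open>The induced linear map on the free algebra and its vanishing on the ideal\<close>

definition word_eval :: "('k, 'g) free_alg \<Rightarrow> 'g" where
  "word_eval a = (\<Sum>w\<in>Poly_Mapping.keys a. scale (Poly_Mapping.lookup a w) (rho_ext [] (letters w)))"

lemma word_eval_superset:
  assumes "finite S" "Poly_Mapping.keys a \<subseteq> S"
  shows "word_eval a = (\<Sum>w\<in>S. scale (Poly_Mapping.lookup a w) (rho_ext [] (letters w)))"
  unfolding word_eval_def by (rule sum.mono_neutral_left) (use assms in \<open>auto simp: in_keys_iff\<close>)

lemma word_eval_add: "word_eval (a + b) = word_eval a + word_eval b"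
proof -
  let ?S = "Poly_Mapping.keys a \<union> Poly_Mapping.keys b"
  have "finite ?S" "Poly_Mapping.keys (a + b) \<subseteq> ?S"
    using keys_add[of a b] by auto
  then show ?thesis
    by (subst (1 2 3) word_eval_superset[of ?S]) (auto simp: lookup_add scale_left_distrib sum.distrib)
qed

lemma word_eval_neg: "word_eval (- a) = - word_eval a"
  by (simp add: word_eval_def scale_minus_left sum_negf)

lemma word_eval_diff: "word_eval (a - b) = word_eval a - word_eval b"
  using word_eval_add[of a "- b"] by (simp add: word_eval_neg)

lemma word_eval_single: "word_eval (Poly_Mapping.single w c) = scale c (rho_ext [] (letters w))"
  by (simp add: word_eval_def)

lemma word_eval_gen: "word_eval (gen x) = x"
  by (simp add: gen_def word_eval_single rho_ext_singleton del: rho_ext.simps)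

text \<open>By additivity \<open>a\<close> and \<open>b\<close> may be taken to be monomials; the
  three kinds of relations are then \<open>rho_ext_add\<close>, \<open>rho_ext_scale\<close> and
  \<open>rho_ext_swap\<close> inside a longer word.\<close>

lemma word_eval_relation:
  assumes "r \<in> envelope_rels scale bracket"
  shows "word_eval (a * r * b) = 0"
proof -
  have "word_eval (Poly_Mapping.single u c * r * Poly_Mapping.single v d) = 0" for u v c d
    using assms unfolding envelope_rels_def
  proof (elim UnE CollectE exE conjE, goal_cases)
    case (1 x y)
    then show ?case
      by (simp add: gen_def ring_distribs left_diff_distrib right_diff_distrib mult_single plus_free_word_def
          word_eval_diff word_eval_single rho_ext_add scale_right_distrib)
  next
    case (2 e x)
    then show ?case
      by (simp add: gen_def const_def left_diff_distrib right_diff_distrib mult_single plus_free_word_def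
          word_eval_diff word_eval_single rho_ext_scale mult.assoc mult.commute[of d])
  next
    case (3 x y)
    have "word_eval (Poly_Mapping.single u c * r * Poly_Mapping.single v d) = scale (c * d)
        (rho_ext [] (letters u @ x # y # letters v) - rho_ext [] (letters u @ y # x # letters v)
          - rho_ext [] (letters u @ bracket x y # letters v))"
      using 3 by (simp add: gen_def left_diff_distrib right_diff_distrib mult_single plus_free_word_def
          word_eval_diff word_eval_single scale_right_diff_distrib)
    then show ?case by (simp add: rho_ext_swap)
  qed
  then have "word_eval (Poly_Mapping.single u c * r * b) = 0" for u c
    using additive_eq_0_free_alg[of "\<lambda>b. word_eval (Poly_Mapping.single u c * r * b)" b]
    by (simp add: distrib_left word_eval_add)
  then show ?thesis
    using additive_eq_0_free_alg[of "\<lambda>a. word_eval (a * r * b)" a]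
    by (simp add: distrib_right word_eval_add)
qed

lemma word_eval_envelope_ideal:
  assumes "a \<in> envelope_ideal scale bracket"
  shows "word_eval a = 0"
proof -
  let ?R = "ring_of_type_algebra :: ('k, 'g) free_alg ring"
  \<comment> \<open>As \<open>word_eval\<close> is only linear, its kernel is replaced by the
    largest two-sided ideal contained in it.\<close>
  let ?J = "{a. \<forall>x y. word_eval (x * a * y) = 0}"
  interpret R: ring ?R by (rule ring_free_alg)
  have minus: "\<ominus>\<^bsub>?R\<^esub> x = - x" for x
    by (rule R.minus_equality) (simp_all add: ring_of_type_algebra_def)
  have "ideal ?J ?R"
  proof (rule idealI[OF ring_free_alg])
    show "subgroup ?J (add_monoid ?R)"
    proof (rule R.add.subgroupI)
      have "0 \<in> ?J" by (simp add: word_eval_def)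
      then show "?J \<noteq> {}" by blast
      show "\<ominus>\<^bsub>?R\<^esub> a \<in> ?J" if "a \<in> ?J" for a
        using that unfolding minus by (simp add: word_eval_neg)
    qed (auto simp: ring_of_type_algebra_def ring_distribs word_eval_add)
  next
    fix a x assume "a \<in> ?J" "x \<in> carrier ?R"
    then show "x \<otimes>\<^bsub>?R\<^esub> a \<in> ?J" by (simp add: ring_of_type_algebra_def mult.assoc[symmetric])
  next
    fix a x assume "a \<in> ?J" "x \<in> carrier ?R"
    then show "a \<otimes>\<^bsub>?R\<^esub> x \<in> ?J" by (simp add: ring_of_type_algebra_def) (metis mult.assoc)
  qed
  then have "envelope_ideal scale bracket \<subseteq> ?J"
    unfolding envelope_ideal_def
    by (rule R.genideal_minimal) (auto simp: word_eval_relation)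
  then have "word_eval (1 * a * 1) = 0" using assms by blast
  then show ?thesis by simp
qed

end

lemma (in lie_algebra) gen_in_envelope_ideal:
  assumes "gen x \<in> envelope_ideal scale bracket"
  shows "x = 0"
proof -
  \<comment> \<open>A well-order of the whole type supplies the strict total order, and extending
    the independent empty set supplies the basis.\<close>
  obtain r :: "('g \<times> 'g) set" where r: "well_order_on UNIV r" using well_order_on by blast
  then have lin: "antisym r" "trans r" "total_on UNIV r"
    by (auto simp: well_order_on_def linear_order_on_def partial_order_on_def preorder_on_def)
  interpret lie_algebra_ordered_basis scale bracket "extend_basis {}" "\<lambda>x y. (x, y) \<in> r \<and> x \<noteq> y"
  proof unfold_locales
    show "independent (extend_basis {})" by (simp add: independent_extend_basis independent_empty)
    show "span (extend_basis {}) = UNIV" by (simp add: span_extend_basis independent_empty)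
  qed (use lin in \<open>auto dest: antisymD transD simp: total_on_def\<close>)
  show ?thesis using word_eval_envelope_ideal[OF assms] by (simp add: word_eval_gen)
qed

section \<open>Exponentials and derivations of noncommutative power series in two variables\<close>

unbundle fps_syntax

text \<open>Nesting univariate series gives the ring structure over noncommutative coefficients for
  free. The outer index is the exponent of \<open>s\<close>, the inner one that of \<open>t\<close>,
  as for \<open>ser\<close>.\<close>

type_synonym 'r fps2 = "'r fps fps"

definition Abs_fps2 :: "(nat \<Rightarrow> nat \<Rightarrow> 'r) \<Rightarrow> 'r fps2" where
  "Abs_fps2 f = Abs_fps (\<lambda>i. Abs_fps (f i))"

lemma Abs_fps2_nth [simp]: "Abs_fps2 f $ i $ j = f i j"
  by (simp add: Abs_fps2_def)

lemma fps2_eqI: "(\<And>i j. F $ i $ j = G $ i $ j) \<Longrightarrow> F = G" for F G :: "'r::zero fps2"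
  by (simp add: fps_ext)

lemma fps2_mult_nth:
  "(F * G) $ i $ j = (\<Sum>a\<le>i. \<Sum>b\<le>j. F $ a $ b * G $ (i - a) $ (j - b))" for F G :: "'r::ring_1 fps2"
  by (simp add: fps_mult_nth fps_sum_nth atLeast0AtMost)

definition order_ge :: "nat \<Rightarrow> 'r::zero fps2 \<Rightarrow> bool" where
  "order_ge n F \<longleftrightarrow> (\<forall>i j. i + j < n \<longrightarrow> F $ i $ j = 0)"

lemma order_ge_0 [simp]: "order_ge 0 F"
  by (simp add: order_ge_def)

lemma order_ge_zero [simp]: "order_ge n 0"
  by (simp add: order_ge_def)

lemma order_ge_1_iff: "order_ge (Suc 0) F \<longleftrightarrow> F $ 0 $ 0 = 0"
  by (simp add: order_ge_def)

lemma order_ge_add: "order_ge n F \<Longrightarrow> order_ge n G \<Longrightarrow> order_ge n (F + G)" for F G :: "'r::ring_1 fps2"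
  by (simp add: order_ge_def)

lemma order_ge_diff: "order_ge n F \<Longrightarrow> order_ge n G \<Longrightarrow> order_ge n (F - G)" for F G :: "'r::ring_1 fps2"
  by (simp add: order_ge_def)

lemma order_ge_mult:
  fixes F G :: "'r::ring_1 fps2"
  assumes "order_ge m F" "order_ge n G"
  shows "order_ge (m + n) (F * G)"
  unfolding order_ge_def
proof (intro allI impI)
  fix i j assume ij: "i + j < m + n"
  have "F $ a $ b * G $ (i - a) $ (j - b) = 0" if "a \<le> i" "b \<le> j" for a b
  proof (cases "a + b < m")
    case False
    then have "(i - a) + (j - b) < n" using that ij by linarith
    then show ?thesis using assms(2) by (simp add: order_ge_def)
  qed (use assms(1) in \<open>simp add: order_ge_def\<close>)
  then show "(F * G) $ i $ j = 0" by (simp add: fps2_mult_nth)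
qed

lemma order_ge_power: "order_ge 1 Y \<Longrightarrow> order_ge n (Y ^ n)" for Y :: "'r::ring_1 fps2"
  using order_ge_mult[of 1 Y] by (induction n) auto

definition euler :: "'r::ring_1 fps2 \<Rightarrow> 'r fps2" where
  "euler F = Abs_fps2 (\<lambda>i j. of_nat (i + j) * F $ i $ j)"

lemma euler_nth: "euler F $ i $ j = of_nat (i + j) * F $ i $ j"
  by (simp add: euler_def)

lemma euler_mult: "euler (F * G) = euler F * G + F * euler G" for F G :: "'r::ring_1 fps2"
proof (rule fps2_eqI)
  fix i j
  have "of_nat (i + j) * (F $ a $ b * G $ (i - a) $ (j - b)) =
      of_nat (a + b) * F $ a $ b * G $ (i - a) $ (j - b) +
      F $ a $ b * (of_nat (i - a + (j - b)) * G $ (i - a) $ (j - b))" if "a \<le> i" "b \<le> j" for a b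
  proof -
    have "i + j = (a + b) + (i - a + (j - b))" using that by simp
    then have "(of_nat (i + j) :: 'r) = of_nat (a + b) + of_nat (i - a + (j - b))"
      by (metis of_nat_add)
    moreover have "F $ a $ b * (of_nat (i - a + (j - b)) * G $ (i - a) $ (j - b)) =
        of_nat (i - a + (j - b)) * (F $ a $ b * G $ (i - a) $ (j - b))"
      by (simp only: mult.assoc[symmetric] mult_of_nat_commute[of _ "F $ a $ b"])
    ultimately show ?thesis by (simp only: distrib_right mult.assoc)
  qed
  then show "euler (F * G) $ i $ j = (euler F * G + F * euler G) $ i $ j"
    by (simp add: euler_nth fps2_mult_nth sum_distrib_left sum.distrib[symmetric] del: of_nat_add)
qed

text \<open>This is \<open>(- ad Y) ^ k\<close> applied to \<open>C\<close>.\<close>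

primrec iter_comm :: "'a::ring \<Rightarrow> 'a \<Rightarrow> nat \<Rightarrow> 'a" where
  "iter_comm Y C 0 = C"
| "iter_comm Y C (Suc k) = iter_comm Y C k * Y - Y * iter_comm Y C k"

text \<open>The Leibniz rule puts \<open>\<delta> Y\<close> in each place of the product. Moving it
  to the right end past the factors \<open>Y\<close> produces the iterated commutators, and Pascal's
  rule counts them.\<close>

lemma derivation_power:
  fixes \<delta> :: "'a::ring_1 \<Rightarrow> 'a"
  assumes leibniz: "\<And>F G. \<delta> (F * G) = \<delta> F * G + F * \<delta> G"
  shows "\<delta> (Y ^ n) = (\<Sum>k<n. of_nat (n choose Suc k) * Y ^ (n - Suc k) * iter_comm Y (\<delta> Y) k)"
proof (induction n)
  case 0
  have "\<delta> 1 = \<delta> 1 + \<delta> 1" using leibniz[of 1 1] by simp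
  then show ?case by simp
next
  case (Suc n)
  let ?d = "iter_comm Y (\<delta> Y)"
  have Y: "?d k * Y = Y * ?d k + ?d (Suc k)" for k by simp
  have pw: "Y ^ (n - Suc k) * Y = Y ^ (n - k)" if "k < n" for k
    using that by (metis Suc_diff_Suc power_Suc2)
  have "\<delta> (Y ^ n) * Y = (\<Sum>k<n. of_nat (n choose Suc k) * Y ^ (n - k) * ?d k)
      + (\<Sum>k<n. of_nat (n choose Suc k) * Y ^ (n - Suc k) * ?d (Suc k))"
    unfolding Suc.IH sum_distrib_right sum.distrib[symmetric]
  proof (rule sum.cong[OF refl])
    fix k assume "k \<in> {..<n}"
    then have "Y ^ (n - Suc k) * Y = Y ^ (n - k)" using pw by simp
    then have "Y ^ (n - Suc k) * (Y * ?d k) = Y ^ (n - k) * ?d k" by (metis mult.assoc)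
    then show "of_nat (n choose Suc k) * Y ^ (n - Suc k) * ?d k * Y =
        of_nat (n choose Suc k) * Y ^ (n - k) * ?d k + of_nat (n choose Suc k) * Y ^ (n - Suc k) * ?d (Suc k)"
      unfolding mult.assoc Y by (simp only: distrib_left mult.assoc)
  qed
  moreover have "(\<Sum>k<n. of_nat (n choose Suc k) * Y ^ (n - k) * ?d k) =
      (\<Sum>k<Suc n. of_nat (n choose Suc k) * Y ^ (n - k) * ?d k)" by (simp add: binomial_eq_0)
  moreover have "(\<Sum>k<n. of_nat (n choose Suc k) * Y ^ (n - Suc k) * ?d (Suc k)) + Y ^ n * \<delta> Y =
      (\<Sum>k<Suc n. of_nat (n choose k) * Y ^ (n - k) * ?d k)"
    by (subst sum.lessThan_Suc_shift) (simp add: add.commute)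
  ultimately have "\<delta> (Y ^ n) * Y + Y ^ n * \<delta> Y =
      (\<Sum>k<Suc n. of_nat (n choose Suc k) * Y ^ (n - k) * ?d k + of_nat (n choose k) * Y ^ (n - k) * ?d k)"
    unfolding sum.distrib by (simp only: add.assoc)
  also have "\<dots> = (\<Sum>k<Suc n. of_nat (Suc n choose Suc k) * Y ^ (Suc n - Suc k) * ?d k)"
    by (rule sum.cong[OF refl]) (simp add: distrib_right add.commute)
  finally show ?case by (simp only: power_Suc2 leibniz)
qed

text \<open>Makes \<open>'r\<close> an algebra over a field of characteristic 0, so that the
  factorials in the exponential series can be inverted.\<close>

locale central_scalars =
  fixes \<kappa> :: "'k::field_char_0 \<Rightarrow> 'r::ring_1"
  assumes scalar_one: "\<kappa> 1 = 1" and scalar_add: "\<kappa> (c + d) = \<kappa> c + \<kappa> d"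
    and scalar_mult: "\<kappa> (c * d) = \<kappa> c * \<kappa> d" and scalar_central: "\<kappa> c * a = a * \<kappa> c"
begin

lemma scalar_zero: "\<kappa> 0 = 0"
  using scalar_add[of 0 0] by simp

lemma scalar_of_nat: "\<kappa> (of_nat n) = of_nat n"
  by (induction n) (simp_all add: scalar_add scalar_one scalar_zero)

abbreviation scalar2 :: "'k \<Rightarrow> 'r fps2" where
  "scalar2 c \<equiv> fps_const (fps_const (\<kappa> c))"

lemma scalar2_mult: "scalar2 (c * d) = scalar2 c * scalar2 d"
  by (simp add: scalar_mult)

lemma scalar2_central: "scalar2 c * F = F * scalar2 c"
  by (rule fps2_eqI) (simp add: scalar_central)

lemma scalar2_of_nat: "scalar2 (of_nat n) = of_nat n"
  by (simp add: scalar_of_nat fps_of_nat)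

definition exp_trunc :: "nat \<Rightarrow> 'r fps2 \<Rightarrow> 'r fps2" where
  "exp_trunc N Y = (\<Sum>n\<le>N. scalar2 (1 / fact n) * Y ^ n)"

text \<open>If \<open>Y\<close> has no constant term, then \<open>Y ^ n\<close> starts in degree
  \<open>n\<close> and later terms do not reach this coefficient. The cut at \<open>i + j\<close> is
  also that of \<open>series_exp\<close>.\<close>

definition exp2 :: "'r fps2 \<Rightarrow> 'r fps2" where
  "exp2 Y = Abs_fps2 (\<lambda>i j. exp_trunc (i + j) Y $ i $ j)"

lemma exp_trunc_nth: "exp_trunc N Y $ i $ j = (\<Sum>n\<le>N. \<kappa> (1 / fact n) * (Y ^ n) $ i $ j)"
  by (simp add: exp_trunc_def fps_sum_nth)

lemma exp2_nth:
  assumes "order_ge 1 Y" "i + j \<le> N"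
  shows "exp2 Y $ i $ j = (\<Sum>n\<le>N. \<kappa> (1 / fact n) * (Y ^ n) $ i $ j)"
proof -
  have "(\<Sum>n\<le>i + j. \<kappa> (1 / fact n) * (Y ^ n) $ i $ j) = (\<Sum>n\<le>N. \<kappa> (1 / fact n) * (Y ^ n) $ i $ j)"
    using assms(2) order_ge_power[OF assms(1)]
    by (intro sum.mono_neutral_left) (auto simp: order_ge_def)
  then show ?thesis by (simp add: exp2_def exp_trunc_nth)
qed

lemma exp2_diff_trunc: "order_ge 1 Y \<Longrightarrow> order_ge (Suc N) (exp2 Y - exp_trunc N Y)"
  by (simp add: order_ge_def exp2_nth[where N = N] exp_trunc_nth)

lemma exp2_nth_0_0: "order_ge 1 Y \<Longrightarrow> exp2 Y $ 0 $ 0 = 1"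
  by (simp add: exp2_nth[where N = 0] scalar_one)

definition log_deriv_term :: "'r fps2 \<Rightarrow> 'r fps2 \<Rightarrow> nat \<Rightarrow> 'r fps2" where
  "log_deriv_term Y C k = scalar2 (1 / fact (Suc k)) * iter_comm Y C k"

text \<open>This is \<open>(1 - exp (- ad Y)) / ad Y\<close> applied to \<open>C\<close>. When
  \<open>Y\<close> and \<open>C\<close> have no constant term, the term with index \<open>k\<close>
  starts in degree \<open>Suc k\<close>, so the cut at \<open>k < i + j\<close> loses
  nothing.\<close>

definition log_deriv :: "'r fps2 \<Rightarrow> 'r fps2 \<Rightarrow> 'r fps2" where
  "log_deriv Y C = Abs_fps2 (\<lambda>i j. (\<Sum>k<i + j. log_deriv_term Y C k) $ i $ j)"

lemma order_ge_iter_comm: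
  fixes Y C :: "'r fps2"
  assumes "order_ge 1 Y" "order_ge 1 C"
  shows "order_ge (Suc k) (iter_comm Y C k)"
proof (induction k)
  case (Suc k)
  then show ?case
    using order_ge_mult[OF assms(1) Suc] order_ge_mult[OF Suc assms(1)]
    by (auto intro!: order_ge_diff)
qed (use assms in simp)

lemma order_ge_scalar2: "order_ge n F \<Longrightarrow> order_ge n (scalar2 c * F)"
  using order_ge_mult[of 0 "scalar2 c" n F] by simp

lemma order_ge_log_deriv_term:
  "order_ge 1 Y \<Longrightarrow> order_ge 1 C \<Longrightarrow> order_ge (Suc k) (log_deriv_term Y C k)"
  unfolding log_deriv_term_def by (intro order_ge_scalar2 order_ge_iter_comm)

lemma log_deriv_diff_trunc:
  assumes "order_ge 1 Y" "order_ge 1 C"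
  shows "order_ge (Suc N) (log_deriv Y C - (\<Sum>k<N. log_deriv_term Y C k))"
  unfolding order_ge_def
proof (intro allI impI)
  fix i j assume ij: "i + j < Suc N"
  have "(\<Sum>k<i + j. log_deriv_term Y C k $ i $ j) = (\<Sum>k<N. log_deriv_term Y C k $ i $ j)"
    using ij order_ge_log_deriv_term[OF assms]
    by (intro sum.mono_neutral_left) (auto simp: order_ge_def)
  then show "(log_deriv Y C - (\<Sum>k<N. log_deriv_term Y C k)) $ i $ j = 0"
    by (simp add: log_deriv_def fps_sum_nth)
qed

lemma order_ge_log_deriv: "order_ge 1 (log_deriv Y C)"
  by (simp add: order_ge_1_iff log_deriv_def)

text \<open>Apply \<open>derivation_power\<close> to each term of the series: the binomial
  coefficient splits \<open>1 / fact n\<close> into \<open>1 / fact (n - Suc k)\<close> and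
  \<open>1 / fact (Suc k)\<close>, which turns the double sum into a product. The derivation is left
  general because both the Euler derivation and a commutator with a fixed series are used.\<close>

lemma derivation_exp2:
  fixes \<delta> :: "'r fps2 \<Rightarrow> 'r fps2"
  assumes leibniz: "\<And>F G. \<delta> (F * G) = \<delta> F * G + F * \<delta> G"
    and add: "\<And>F G. \<delta> (F + G) = \<delta> F + \<delta> G"
    and scalar: "\<And>c F. \<delta> (scalar2 c * F) = scalar2 c * \<delta> F"
    and order: "\<And>n F. order_ge n F \<Longrightarrow> order_ge n (\<delta> F)"
    and Y: "order_ge 1 Y"
  shows "\<delta> (exp2 Y) = exp2 Y * log_deriv Y (\<delta> Y)"
proof (rule fps2_eqI)
  fix i j :: nat
  define N where "N = i + j"
  let ?p = "\<lambda>n. scalar2 (1 / fact n) * Y ^ n" and ?e = "log_deriv_term Y (\<delta> Y)"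
  let ?L = "\<Sum>k<N. ?e k"
  have dX: "order_ge 1 (\<delta> Y)" by (rule order[OF Y])
  have zero: "\<delta> 0 = 0" using add[of 0 0] by simp
  have sum: "\<delta> (sum F S) = (\<Sum>n\<in>S. \<delta> (F n))" for F and S :: "nat set"
    by (induction S rule: infinite_finite_induct) (simp_all add: zero add)
  have p: "\<delta> (?p n) = (\<Sum>k<n. ?p (n - Suc k) * ?e k)" for n
    unfolding scalar derivation_power[of \<delta>, OF leibniz] sum_distrib_left
  proof (rule sum.cong[OF refl])
    fix k assume "k \<in> {..<n}"
    then have "1 / fact n * of_nat (n choose Suc k) = 1 / fact (n - Suc k) * (1 / (fact (Suc k) :: 'k))"
      by (simp add: binomial_fact del: fact_Suc)
    then have 1: "scalar2 (1 / fact n) * of_nat (n choose Suc k) =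
        scalar2 (1 / fact (n - Suc k)) * scalar2 (1 / fact (Suc k))"
      by (simp only: scalar2_mult[symmetric] scalar2_of_nat[symmetric])
    have 2: "scalar2 (1 / fact (n - Suc k)) * scalar2 (1 / fact (Suc k)) * Y ^ (n - Suc k) =
        scalar2 (1 / fact (n - Suc k)) * Y ^ (n - Suc k) * scalar2 (1 / fact (Suc k))"
      by (simp only: mult.assoc scalar2_central[of "1 / fact (Suc k)" "Y ^ (n - Suc k)"])
    show "scalar2 (1 / fact n) * (of_nat (n choose Suc k) * Y ^ (n - Suc k) * iter_comm Y (\<delta> Y) k) =
        scalar2 (1 / fact (n - Suc k)) * Y ^ (n - Suc k) * log_deriv_term Y (\<delta> Y) k"
      unfolding log_deriv_term_def by (simp only: mult.assoc[symmetric] 1 2)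
  qed
  have "\<delta> (exp_trunc N Y) = (\<Sum>(n, k)\<in>(SIGMA n:{..N}. {..<n}). ?p (n - Suc k) * ?e k)"
    by (simp only: exp_trunc_def sum p) (simp add: sum.Sigma)
  also have "\<dots> = (\<Sum>(m, k)\<in>{(m, k). m + k < N}. ?p m * ?e k)"
    by (rule sum.reindex_bij_witness[where i = "\<lambda>(m, k). (m + Suc k, k)" and j = "\<lambda>(n, k). (n - Suc k, k)"]) auto
  finally have 1: "\<delta> (exp_trunc N Y) = \<dots>" .
  have "exp_trunc N Y * ?L = (\<Sum>(m, k)\<in>{..N} \<times> {..<N}. ?p m * ?e k)"
    unfolding exp_trunc_def sum_product sum.cartesian_product ..
  \<comment> \<open>The pairs with \<open>m + k\<close> at least \<open>N\<close> start in degree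
    \<open>m + Suc k\<close>, beyond \<open>i + j\<close>.\<close>
  also have "\<dots> $ i $ j = (\<Sum>(m, k)\<in>{(m, k). m + k < N}. ?p m * ?e k) $ i $ j"
    unfolding fps_sum_nth
  proof (rule sum.mono_neutral_right)
    show "\<forall>z\<in>{..N} \<times> {..<N} - {(m, k). m + k < N}. (case z of (m, k) \<Rightarrow> ?p m * ?e k) $ i $ j = 0"
    proof
      fix z assume "z \<in> {..N} \<times> {..<N} - {(m, k). m + k < N}"
      then obtain m k where z: "z = (m, k)" and mk: "i + j < m + Suc k" by (auto simp: N_def)
      have "order_ge (m + Suc k) (?p m * ?e k)"
        by (intro order_ge_mult order_ge_scalar2 order_ge_power order_ge_log_deriv_term Y dX)
      then show "(case z of (m, k) \<Rightarrow> ?p m * ?e k) $ i $ j = 0"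
        using mk unfolding order_ge_def z prod.case by blast
    qed
  qed auto
  finally have 2: "\<delta> (exp_trunc N Y) $ i $ j = (exp_trunc N Y * ?L) $ i $ j"
    using 1 by simp
  have "order_ge (Suc N) (\<delta> (exp2 Y - exp_trunc N Y))"
    by (rule order[OF exp2_diff_trunc[OF Y]])
  moreover have "\<delta> (exp2 Y) = \<delta> (exp2 Y - exp_trunc N Y) + \<delta> (exp_trunc N Y)"
    by (simp flip: add)
  ultimately have 3: "\<delta> (exp2 Y) $ i $ j = \<delta> (exp_trunc N Y) $ i $ j"
    by (simp add: order_ge_def N_def)
  have "order_ge (Suc N + 0) ((exp2 Y - exp_trunc N Y) * log_deriv Y (\<delta> Y))"
    "order_ge (0 + Suc N) (exp_trunc N Y * (log_deriv Y (\<delta> Y) - ?L))"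
    by (intro order_ge_mult exp2_diff_trunc log_deriv_diff_trunc Y dX order_ge_0)+
  moreover have "exp2 Y * log_deriv Y (\<delta> Y) = (exp2 Y - exp_trunc N Y) * log_deriv Y (\<delta> Y)
      + exp_trunc N Y * (log_deriv Y (\<delta> Y) - ?L) + exp_trunc N Y * ?L"
    by (simp add: algebra_simps)
  ultimately have "(exp2 Y * log_deriv Y (\<delta> Y)) $ i $ j = (exp_trunc N Y * ?L) $ i $ j"
    by (simp add: order_ge_def N_def)
  then show "\<delta> (exp2 Y) $ i $ j = (exp2 Y * log_deriv Y (\<delta> Y)) $ i $ j"
    using 2 3 by simp
qed

lemma euler_exp2:
  assumes Y: "order_ge 1 Y"
  shows "euler (exp2 Y) = exp2 Y * log_deriv Y (euler Y)"
proof (rule derivation_exp2[OF _ _ _ _ Y])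
  show "euler (F * G) = euler F * G + F * euler G" for F G :: "'r fps2" by (rule euler_mult)
  show "euler (F + G) = euler F + euler G" for F G :: "'r fps2"
    by (rule fps2_eqI) (simp add: euler_nth distrib_left)
  show "euler (scalar2 c * F) = scalar2 c * euler F" for c F
    by (rule fps2_eqI) (simp add: euler_nth mult.assoc[symmetric] scalar_central[of c "of_nat n" for n] del: of_nat_add)
  show "order_ge n (euler F)" if "order_ge n F" for n and F :: "'r fps2"
    using that by (simp add: order_ge_def euler_nth)
qed

text \<open>The case of the inner derivation \<open>\<lambda>F. C * F - F * C\<close>. It describes
  the conjugate of \<open>C\<close> by \<open>exp2 Y\<close> without an inverse of the
  exponential.\<close>

lemma commute_exp2:
  assumes Y: "order_ge 1 Y"
  shows "C * exp2 Y = exp2 Y * (C + log_deriv Y (C * Y - Y * C))"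
proof -
  let ?\<delta> = "\<lambda>F. C * F - F * C"
  have "?\<delta> (exp2 Y) = exp2 Y * log_deriv Y (?\<delta> Y)"
  proof (rule derivation_exp2[OF _ _ _ _ Y])
    show "?\<delta> (scalar2 c * F) = scalar2 c * ?\<delta> F" for c F
      by (simp only: right_diff_distrib mult.assoc[symmetric] scalar2_central[of c C, symmetric])
    show "order_ge n (?\<delta> F)" if "order_ge n F" for n F
      using order_ge_mult[of 0 C n F] order_ge_mult[of n F 0 C] that by (auto intro: order_ge_diff)
  qed (simp_all add: algebra_simps)
  then show ?thesis by (simp add: algebra_simps)
qed

end

section \<open>Products and exponentials of series that agree near the origin\<close>

lemma fps2_mult_nth_rev:
  "(F * G) $ i $ j = (\<Sum>a\<le>i. \<Sum>b\<le>j. F $ (i - a) $ (j - b) * G $ a $ b)" for F G :: "'r::ring_1 fps2"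
proof -
  have rev: "(\<Sum>a\<le>n. h a) = (\<Sum>a\<le>n. h (n - a))" for h :: "nat \<Rightarrow> 'r" and n
    by (rule sum.reindex_bij_witness[where i = "\<lambda>a. n - a" and j = "\<lambda>a. n - a"]) auto
  show ?thesis
    unfolding fps2_mult_nth by (subst rev, subst (2) rev) simp
qed

text \<open>A coefficient of a product depends only on the rectangle below its position. Comparing
  on rectangles instead of by total degree keeps positions of equal degree independent of each
  other.\<close>

definition agree_upto :: "nat \<Rightarrow> nat \<Rightarrow> 'r fps2 \<Rightarrow> 'r fps2 \<Rightarrow> bool" where
  "agree_upto i j F G \<longleftrightarrow> (\<forall>k\<le>i. \<forall>l\<le>j. F $ k $ l = G $ k $ l)"

definition agree_below :: "nat \<Rightarrow> nat \<Rightarrow> 'r fps2 \<Rightarrow> 'r fps2 \<Rightarrow> bool" where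
  "agree_below i j F G \<longleftrightarrow> (\<forall>k\<le>i. \<forall>l\<le>j. (k, l) \<noteq> (i, j) \<longrightarrow> F $ k $ l = G $ k $ l)"

lemma agree_below_upto:
  "agree_below i j F G \<Longrightarrow> k \<le> i \<Longrightarrow> l \<le> j \<Longrightarrow> (k, l) \<noteq> (i, j) \<Longrightarrow> agree_upto k l F G"
  unfolding agree_below_def agree_upto_def by (metis le_antisym le_trans prod.inject)

lemma agree_upto_mult:
  fixes F F' G G' :: "'r::ring_1 fps2"
  assumes "agree_upto i j F F'" "agree_upto i j G G'"
  shows "agree_upto i j (F * G) (F' * G')"
  unfolding agree_upto_def fps2_mult_nth
proof (intro allI impI)
  fix k l assume "k \<le> i" "l \<le> j"
  then show "(\<Sum>a\<le>k. \<Sum>b\<le>l. F $ a $ b * G $ (k - a) $ (l - b)) =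
      (\<Sum>a\<le>k. \<Sum>b\<le>l. F' $ a $ b * G' $ (k - a) $ (l - b))"
    using assms by (intro sum.cong refl) (simp add: agree_upto_def)
qed

lemma agree_upto_power: "agree_upto i j F G \<Longrightarrow> agree_upto i j (F ^ n) (G ^ n)"
  for F G :: "'r::ring_1 fps2"
proof (induction n)
  case 0
  then show ?case by (simp add: agree_upto_def)
next
  case (Suc n)
  then show ?case by (simp add: agree_upto_mult)
qed

lemma double_sum_single:
  fixes h :: "nat \<Rightarrow> nat \<Rightarrow> 'r::ring_1"
  assumes "\<And>a b. a \<le> i \<Longrightarrow> b \<le> j \<Longrightarrow> (a, b) \<noteq> (c, d) \<Longrightarrow> h a b = 0" "c \<le> i" "d \<le> j"
  shows "(\<Sum>a\<le>i. \<Sum>b\<le>j. h a b) = h c d"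
proof -
  have "(\<Sum>a\<le>i. \<Sum>b\<le>j. h a b) = (\<Sum>(a, b)\<in>{..i} \<times> {..j}. h a b)"
    by (simp add: sum.cartesian_product)
  also have "\<dots> = (\<Sum>(a, b)\<in>{(c, d)}. h a b)"
    by (rule sum.mono_neutral_right) (use assms in auto)
  finally show ?thesis by simp
qed

text \<open>In \<open>(F - F') * G + F' * (G - G')\<close> only the corner of each difference
  survives, and it is multiplied by a constant term.\<close>

lemma mult_nth_diff_agree_below:
  fixes F F' G G' :: "'r::ring_1 fps2"
  assumes F: "agree_below i j F F'" and G: "agree_below i j G G'" and ij: "(i, j) \<noteq> (0, 0)"
  shows "(F * G) $ i $ j - (F' * G') $ i $ j =
    (F $ i $ j - F' $ i $ j) * G $ 0 $ 0 + F' $ 0 $ 0 * (G $ i $ j - G' $ i $ j)"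
proof -
  have "(F * G) $ i $ j - (F' * G') $ i $ j = ((F - F') * G) $ i $ j + (F' * (G - G')) $ i $ j"
    by (simp add: algebra_simps)
  moreover have "((F - F') * G) $ i $ j = (F - F') $ i $ j * G $ (i - i) $ (j - j)"
    unfolding fps2_mult_nth
    by (rule double_sum_single) (use F in \<open>auto simp: agree_below_def\<close>)
  moreover have "(F' * (G - G')) $ i $ j = F' $ (i - i) $ (j - j) * (G - G') $ i $ j"
    unfolding fps2_mult_nth_rev
    by (rule double_sum_single) (use G in \<open>auto simp: agree_below_def\<close>)
  ultimately show ?thesis by simp
qed

context central_scalars
begin

lemma exp2_agree_upto:
  assumes "agree_upto i j Y Z" "order_ge 1 Y" "order_ge 1 Z"
  shows "agree_upto i j (exp2 Y) (exp2 Z)"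
  unfolding agree_upto_def
proof (intro allI impI)
  fix k l assume "k \<le> i" "l \<le> j"
  then have "(Y ^ n) $ k $ l = (Z ^ n) $ k $ l" for n
    using agree_upto_power[OF assms(1), of n] by (simp add: agree_upto_def)
  then show "exp2 Y $ k $ l = exp2 Z $ k $ l"
    by (simp add: exp2_nth[OF assms(2) order_refl] exp2_nth[OF assms(3) order_refl])
qed

lemma exp2_agree_below:
  assumes "agree_below i j Y Z" "order_ge 1 Y" "order_ge 1 Z"
  shows "agree_below i j (exp2 Y) (exp2 Z)"
  unfolding agree_below_def
proof (intro allI impI)
  fix k l assume "k \<le> i" "l \<le> j" "(k, l) \<noteq> (i, j)"
  then have "agree_upto k l (exp2 Y) (exp2 Z)"
    by (intro exp2_agree_upto agree_below_upto[OF assms(1)] assms)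
  then show "exp2 Y $ k $ l = exp2 Z $ k $ l" by (simp add: agree_upto_def)
qed

text \<open>As both constant terms are 0, in the powers from the second on the corner coefficient is
  multiplied by 0; only the linear term of the exponential sees it.\<close>

lemma exp2_nth_diff_agree_below:
  assumes YZ: "agree_below i j Y Z" and Y: "order_ge 1 Y" and Z: "order_ge 1 Z"
  shows "exp2 Y $ i $ j - exp2 Z $ i $ j = Y $ i $ j - Z $ i $ j"
proof (cases "(i, j) = (0, 0)")
  case True
  then show ?thesis using Y Z by (simp add: exp2_nth_0_0 order_ge_1_iff)
next
  case False
  have Y0: "Y $ 0 $ 0 = 0" "Z $ 0 $ 0 = 0" using Y Z by (simp_all add: order_ge_1_iff)
  have "(Y ^ n) $ i $ j - (Z ^ n) $ i $ j = (if n = 1 then Y $ i $ j - Z $ i $ j else 0)" for n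
  proof (cases n)
    case (Suc m)
    have "agree_below i j (Y ^ m) (Z ^ m)"
      unfolding agree_below_def
      using agree_upto_power[OF agree_below_upto[OF YZ]] by (simp add: agree_upto_def)
    then have "(Y ^ n) $ i $ j - (Z ^ n) $ i $ j = (Z ^ m) $ 0 $ 0 * (Y $ i $ j - Z $ i $ j)"
      unfolding Suc power_Suc2 using mult_nth_diff_agree_below[OF _ YZ False] Y0 by simp
    moreover have "(Z ^ m) $ 0 $ 0 = (if m = 0 then 1 else 0)"
      using Y0 by (cases m) simp_all
    ultimately show ?thesis using Suc by simp
  qed simp
  then have "(\<Sum>n\<le>i + j. \<kappa> (1 / fact n) * ((Y ^ n) $ i $ j - (Z ^ n) $ i $ j)) =
      (\<Sum>n\<le>i + j. if n = 1 then Y $ i $ j - Z $ i $ j else 0)"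
    by (intro sum.cong refl) (simp add: scalar_one)
  also have "\<dots> = Y $ i $ j - Z $ i $ j"
    using False by (subst sum.delta) auto
  finally show ?thesis
    by (simp add: exp2_nth[OF Y order_refl] exp2_nth[OF Z order_refl] right_diff_distrib sum_subtractf)
qed

text \<open>To first order both exponents enter additively. This gives uniqueness of the factors as
  well as the correction of an approximate factorization.\<close>

lemma exp2_mult_nth_diff:
  assumes "agree_below i j Y Y'" "agree_below i j Z Z'" "(i, j) \<noteq> (0, 0)"
    and ord: "order_ge 1 Y" "order_ge 1 Y'" "order_ge 1 Z" "order_ge 1 Z'"
  shows "(exp2 Y * exp2 Z) $ i $ j - (exp2 Y' * exp2 Z') $ i $ j =
    (Y $ i $ j - Y' $ i $ j) + (Z $ i $ j - Z' $ i $ j)"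
  using mult_nth_diff_agree_below[OF exp2_agree_below exp2_agree_below assms(3)] assms
  by (simp add: exp2_nth_0_0 exp2_nth_diff_agree_below)

lemma exp2_nth_1_1:
  assumes "order_ge 1 Y"
  shows "exp2 Y $ 1 $ 1 = Y $ 1 $ 1 + \<kappa> (1 / 2) * (Y $ 0 $ 1 * Y $ 1 $ 0 + Y $ 1 $ 0 * Y $ 0 $ 1)"
  using assms
  by (simp add: exp2_nth[OF assms, of _ _ 2] numeral_2_eq_2 scalar_one order_ge_1_iff)

lemma exp2_nth_0_1: "order_ge 1 Y \<Longrightarrow> exp2 Y $ 0 $ 1 = Y $ 0 $ 1"
  and exp2_nth_1_0: "order_ge 1 Y \<Longrightarrow> exp2 Y $ 1 $ 0 = Y $ 1 $ 0"
  by (simp_all add: exp2_nth[where N = 1] scalar_one)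

text \<open>In degree one each exponent lives on a single axis, so its square contributes nothing at
  \<open>(1, 1)\<close>. The mixed products that remain are the source of the bracket in the lowest
  order terms.\<close>

lemma exp2_mult_nth_1_1:
  assumes "order_ge 1 Y" "order_ge 1 Z"
    and "Y $ 0 $ 1 = 0 \<or> Y $ 1 $ 0 = 0" "Z $ 0 $ 1 = 0 \<or> Z $ 1 $ 0 = 0"
  shows "(exp2 Y * exp2 Z) $ 1 $ 1 =
    Y $ 1 $ 1 + Z $ 1 $ 1 + Y $ 0 $ 1 * Z $ 1 $ 0 + Y $ 1 $ 0 * Z $ 0 $ 1"
proof -
  have "exp2 Y $ 1 $ 1 = Y $ 1 $ 1" "exp2 Z $ 1 $ 1 = Z $ 1 $ 1"
    using exp2_nth_1_1[OF assms(1)] exp2_nth_1_1[OF assms(2)] assms(3,4) by auto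
  then show ?thesis
    using exp2_nth_0_1[OF assms(1)] exp2_nth_1_0[OF assms(1)] exp2_nth_0_1[OF assms(2)] exp2_nth_1_0[OF assms(2)]
      exp2_nth_0_0[OF assms(1)] exp2_nth_0_0[OF assms(2)]
    by (simp add: algebra_simps)
qed

end

section \<open>Factorization modulo the envelope relations\<close>

text \<open>The enveloping algebra enters only as an algebra \<open>'r\<close> with a two-sided ideal \<open>J\<close> such that \<open>\<iota>\<close>
  is modulo \<open>J\<close> an injective Lie algebra homomorphism.\<close>

locale lie_envelope = lie_algebra scale bracket + central_scalars \<kappa>
  for scale :: "'k::field_char_0 \<Rightarrow> 'g::ab_group_add \<Rightarrow> 'g" and bracket :: "'g \<Rightarrow> 'g \<Rightarrow> 'g"
    and \<kappa> :: "'k \<Rightarrow> 'r::ring_1" +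
  fixes \<iota> :: "'g \<Rightarrow> 'r" and J :: "'r set"
  assumes J_zero: "0 \<in> J" and J_add: "a \<in> J \<Longrightarrow> b \<in> J \<Longrightarrow> a + b \<in> J"
    and J_left: "a \<in> J \<Longrightarrow> r * a \<in> J" and J_right: "a \<in> J \<Longrightarrow> a * r \<in> J"
    and inc_zero: "\<iota> 0 = 0"
    and inc_add: "\<iota> (x + y) - \<iota> x - \<iota> y \<in> J"
    and inc_scale: "\<iota> (scale c x) - \<kappa> c * \<iota> x \<in> J"
    and inc_bracket: "\<iota> x * \<iota> y - \<iota> y * \<iota> x - \<iota> (bracket x y) \<in> J"
    and inc_inj: "\<iota> x \<in> J \<Longrightarrow> x = 0"
begin

lemma J_neg: "a \<in> J \<Longrightarrow> - a \<in> J"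
  using J_left[of a "-1"] by simp

lemma J_diff: "a \<in> J \<Longrightarrow> b \<in> J \<Longrightarrow> a - b \<in> J"
  using J_add[of a "- b"] J_neg by simp

lemma J_sum: "(\<And>x. x \<in> S \<Longrightarrow> f x \<in> J) \<Longrightarrow> sum f S \<in> J"
  by (induction S rule: infinite_finite_induct) (auto intro: J_zero J_add)

section \<open>Lie elements and Lie series modulo the ideal\<close>

definition lie_part :: "'r set" where
  "lie_part = {a. \<exists>x. a - \<iota> x \<in> J}"

lemma J_lie_part: "a \<in> J \<Longrightarrow> a \<in> lie_part"
  unfolding lie_part_def by (auto intro: exI[of _ 0] simp: inc_zero)

lemma inc_lie_part: "\<iota> x \<in> lie_part"
  unfolding lie_part_def using J_zero by (auto intro!: exI[of _ x])

lemma lie_part_add: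
  assumes "a \<in> lie_part" "b \<in> lie_part"
  shows "a + b \<in> lie_part"
proof -
  obtain x y where u: "a - \<iota> x \<in> J" and v: "b - \<iota> y \<in> J" using assms by (auto simp: lie_part_def)
  have "(a - \<iota> x) + (b - \<iota> y) - (\<iota> (x + y) - \<iota> x - \<iota> y) \<in> J"
    by (rule J_diff[OF J_add[OF u v] inc_add])
  then have "a + b - \<iota> (x + y) \<in> J" by (simp add: algebra_simps)
  then show ?thesis by (auto simp: lie_part_def)
qed

lemma lie_part_scale:
  assumes "a \<in> lie_part"
  shows "\<kappa> c * a \<in> lie_part"
proof -
  obtain x where "a - \<iota> x \<in> J" using assms by (auto simp: lie_part_def)
  then have "\<kappa> c * (a - \<iota> x) - (\<iota> (scale c x) - \<kappa> c * \<iota> x) \<in> J"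
    by (rule J_diff[OF J_left inc_scale])
  then have "\<kappa> c * a - \<iota> (scale c x) \<in> J" by (simp add: algebra_simps)
  then show ?thesis by (auto simp: lie_part_def)
qed

lemma lie_part_of_nat: "a \<in> lie_part \<Longrightarrow> of_nat n * a \<in> lie_part"
  using lie_part_scale[of a "of_nat n"] by (simp add: scalar_of_nat)

lemma lie_part_diff:
  assumes "a \<in> lie_part" "b \<in> lie_part"
  shows "a - b \<in> lie_part"
proof -
  have "\<kappa> (- 1) = - 1"
    using scalar_add[of 1 "- 1"] minus_unique[of 1 "\<kappa> (- 1)"] by (simp add: scalar_one scalar_zero)
  then show ?thesis using lie_part_add[OF assms(1) lie_part_scale[OF assms(2), of "- 1"]] by simp
qed

lemma lie_part_sum: "(\<And>x. x \<in> S \<Longrightarrow> f x \<in> lie_part) \<Longrightarrow> sum f S \<in> lie_part"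
  by (induction S rule: infinite_finite_induct) (auto intro: J_lie_part J_zero lie_part_add)

lemma lie_part_commutator:
  assumes "a \<in> lie_part" "b \<in> lie_part"
  shows "a * b - b * a \<in> lie_part"
proof -
  obtain x y where u: "a - \<iota> x \<in> J" and v: "b - \<iota> y \<in> J" using assms by (auto simp: lie_part_def)
  have "(\<iota> x * \<iota> y - \<iota> y * \<iota> x - \<iota> (bracket x y)) + ((a - \<iota> x) * b + \<iota> x * (b - \<iota> y))
      - ((b - \<iota> y) * a + \<iota> y * (a - \<iota> x)) \<in> J"
    by (rule J_diff[OF J_add[OF inc_bracket J_add[OF J_right[OF u] J_left[OF v]]] J_add[OF J_right[OF v] J_left[OF u]]])
  then have "a * b - b * a - \<iota> (bracket x y) \<in> J" by (simp add: algebra_simps)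
  then show ?thesis by (auto simp: lie_part_def)
qed

definition lie_series :: "'r fps2 \<Rightarrow> bool" where
  "lie_series F \<longleftrightarrow> (\<forall>i j. F $ i $ j \<in> lie_part)"

lemma lie_series_add: "lie_series F \<Longrightarrow> lie_series G \<Longrightarrow> lie_series (F + G)"
  by (simp add: lie_series_def lie_part_add)

lemma lie_series_diff: "lie_series F \<Longrightarrow> lie_series G \<Longrightarrow> lie_series (F - G)"
  by (simp add: lie_series_def lie_part_diff)

lemma lie_series_commutator:
  assumes "lie_series F" "lie_series G"
  shows "lie_series (F * G - G * F)"
  unfolding lie_series_def
proof (intro allI)
  fix i j
  have "(F * G - G * F) $ i $ j = (\<Sum>a\<le>i. \<Sum>b\<le>j.
      F $ a $ b * G $ (i - a) $ (j - b) - G $ (i - a) $ (j - b) * F $ a $ b)"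
    by (simp add: fps2_mult_nth[of F] fps2_mult_nth_rev[of G] sum_subtractf)
  also have "\<dots> \<in> lie_part"
    using assms by (intro lie_part_sum lie_part_commutator) (simp_all add: lie_series_def)
  finally show "(F * G - G * F) $ i $ j \<in> lie_part" .
qed

lemma lie_series_euler: "lie_series F \<Longrightarrow> lie_series (euler F)"
  unfolding lie_series_def euler_nth by (blast intro: lie_part_of_nat)

lemma lie_series_log_deriv:
  assumes "lie_series Y" "lie_series C"
  shows "lie_series (log_deriv Y C)"
proof -
  have "lie_series (iter_comm Y C k)" for k
    by (induction k) (auto intro: assms lie_series_commutator)
  then show ?thesis
    by (auto simp: lie_series_def log_deriv_def log_deriv_term_def fps_sum_nth
        intro!: lie_part_sum lie_part_scale)
qed

text \<open>This replaces the Baker-Campbell-Hausdorff theorem: a product of two exponentials of Lie series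
  has a Lie series as logarithmic derivative with respect to the Euler derivation.\<close>

lemma euler_exp2_mult:
  assumes lie: "lie_series Y" "lie_series Z" and ord: "order_ge 1 Y" "order_ge 1 Z"
  obtains \<omega> where "lie_series \<omega>" "order_ge 1 \<omega>" "euler (exp2 Y * exp2 Z) = exp2 Y * exp2 Z * \<omega>"
proof
  let ?\<omega> = "log_deriv Y (euler Y)" and ?\<eta> = "log_deriv Z (euler Z)"
  \<comment> \<open>The Leibniz rule leaves \<open>?\<omega>\<close> between the two exponentials;
    the middle summand is the cost of moving it to the right of \<open>exp2 Z\<close>.\<close>
  let ?\<theta> = "?\<omega> + log_deriv Z (?\<omega> * Z - Z * ?\<omega>) + ?\<eta>"
  show "lie_series ?\<theta>"
    by (intro lie_series_add lie_series_log_deriv lie_series_commutator lie_series_euler lie)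
  show "order_ge 1 ?\<theta>" by (intro order_ge_add order_ge_log_deriv)
  have "euler (exp2 Y * exp2 Z) = exp2 Y * (?\<omega> * exp2 Z) + exp2 Y * (exp2 Z * ?\<eta>)"
    by (simp only: euler_mult euler_exp2[OF ord(1)] euler_exp2[OF ord(2)] mult.assoc)
  also have "\<dots> = exp2 Y * exp2 Z * ?\<theta>"
    unfolding commute_exp2[OF ord(2), of ?\<omega>] by (simp only: distrib_left mult.assoc)
  finally show "euler (exp2 Y * exp2 Z) = exp2 Y * exp2 Z * ?\<theta>" .
qed

text \<open>Compare coefficients in
  \<open>euler (A - B) = A * (\<omega> - \<eta>) + (A - B) * \<eta>\<close>. As
  \<open>\<eta>\<close> has no constant term, the last product lies in \<open>J\<close> up to degree
  \<open>n\<close>; as \<open>A\<close> starts with 1, the other one reduces in degree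
  \<open>n\<close> to \<open>\<omega> - \<eta>\<close>, a Lie series. Finally divide by
  \<open>n\<close>.\<close>

lemma leading_coeff_diff_lie_part:
  assumes A: "A $ 0 $ 0 = 1" "euler A = A * \<omega>" "lie_series \<omega>" "order_ge 1 \<omega>"
    and B: "B $ 0 $ 0 = 1" "euler B = B * \<eta>" "lie_series \<eta>" "order_ge 1 \<eta>"
    and cong: "\<And>k l. k + l < n \<Longrightarrow> (A - B) $ k $ l \<in> J"
    and ij: "i + j = n" "0 < n"
  shows "(A - B) $ i $ j \<in> lie_part"
proof -
  have eq: "euler (A - B) = A * (\<omega> - \<eta>) + (A - B) * \<eta>"
  proof -
    have "euler (A - B) = euler A - euler B"
      by (rule fps2_eqI) (simp add: euler_nth right_diff_distrib)
    then show ?thesis by (simp add: A B algebra_simps)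
  qed
  have R: "((A - B) * \<eta>) $ k $ l \<in> J" if "k + l \<le> n" for k l
    unfolding fps2_mult_nth
  proof (intro J_sum)
    fix a b assume ab: "a \<in> {..k}" "b \<in> {..l}"
    show "(A - B) $ a $ b * \<eta> $ (k - a) $ (l - b) \<in> J"
    proof (cases "a + b < n")
      case True
      then show ?thesis by (intro J_right cong)
    next
      case False
      then have "k - a = 0" "l - b = 0" using ab that by auto
      then show ?thesis using B(4) by (simp add: order_ge_1_iff J_zero)
    qed
  qed
  \<comment> \<open>Here \<open>A\<close> may be replaced by 1: its remaining coefficients are
    multiplied by coefficients of \<open>\<omega> - \<eta>\<close> that are already in
    \<open>J\<close>.\<close>
  have main: "of_nat (k + l) * (A - B) $ k $ l - (\<omega> - \<eta>) $ k $ l \<in> J"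
    if kl: "k + l \<le> n" and below: "\<And>a b. a \<le> k \<Longrightarrow> b \<le> l \<Longrightarrow> (a, b) \<noteq> (k, l) \<Longrightarrow> (\<omega> - \<eta>) $ a $ b \<in> J" for k l
  proof -
    have "(A * (\<omega> - \<eta>)) $ k $ l - (1 * (\<omega> - \<eta>)) $ k $ l = ((A - 1) * (\<omega> - \<eta>)) $ k $ l"
      by (simp add: left_diff_distrib)
    also have "\<dots> \<in> J"
      unfolding fps2_mult_nth_rev
    proof (intro J_sum)
      fix a b assume ab: "a \<in> {..k}" "b \<in> {..l}"
      show "(A - 1) $ (k - a) $ (l - b) * (\<omega> - \<eta>) $ a $ b \<in> J"
      proof (cases "(a, b) = (k, l)")
        case True
        then show ?thesis using A(1) by (simp add: J_zero)
      next
        case False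
        then show ?thesis using ab by (intro J_left below) auto
      qed
    qed
    finally have "(A * (\<omega> - \<eta>)) $ k $ l - (\<omega> - \<eta>) $ k $ l + ((A - B) * \<eta>) $ k $ l \<in> J"
      using R[OF kl] by (simp add: J_add)
    moreover have "of_nat (k + l) * (A - B) $ k $ l = (A * (\<omega> - \<eta>)) $ k $ l + ((A - B) * \<eta>) $ k $ l"
      by (simp only: euler_nth[symmetric] eq fps_add_nth)
    ultimately show ?thesis by (simp only: diff_add_eq)
  qed
  \<comment> \<open>Below degree \<open>n\<close> the term with \<open>A - B\<close> in
    \<open>main\<close> is in \<open>J\<close>, hence so is \<open>\<omega> - \<eta>\<close>, one
    degree after another.\<close>
  have small: "(\<omega> - \<eta>) $ k $ l \<in> J" if "k + l < n" for k l
    using that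
  proof (induction "k + l" arbitrary: k l rule: less_induct)
    case less
    have d: "of_nat (k + l) * (A - B) $ k $ l - (\<omega> - \<eta>) $ k $ l \<in> J"
    proof (rule main)
      fix a b assume "a \<le> k" "b \<le> l" "(a, b) \<noteq> (k, l)"
      then have "a + b < k + l" by auto
      then show "(\<omega> - \<eta>) $ a $ b \<in> J" using less by simp
    qed (use less in simp)
    have "of_nat (k + l) * (A - B) $ k $ l - (of_nat (k + l) * (A - B) $ k $ l - (\<omega> - \<eta>) $ k $ l) \<in> J"
      by (rule J_diff[OF J_left[OF cong[OF less.prems]] d])
    then show ?case by (simp add: algebra_simps)
  qed
  have "of_nat n * (A - B) $ i $ j - (\<omega> - \<eta>) $ i $ j \<in> J"
    unfolding ij(1)[symmetric]
  proof (rule main)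
    fix a b assume "a \<le> i" "b \<le> j" "(a, b) \<noteq> (i, j)"
    then show "(\<omega> - \<eta>) $ a $ b \<in> J" using ij by (intro small) auto
  qed (use ij in simp)
  moreover have "(\<omega> - \<eta>) $ i $ j \<in> lie_part"
    using lie_series_diff[OF A(3) B(3)] by (simp add: lie_series_def)
  ultimately have "(of_nat n * (A - B) $ i $ j - (\<omega> - \<eta>) $ i $ j) + (\<omega> - \<eta>) $ i $ j \<in> lie_part"
    by (rule lie_part_add[OF J_lie_part])
  then have "of_nat n * (A - B) $ i $ j \<in> lie_part" by (simp only: diff_add_cancel)
  then have "\<kappa> (1 / of_nat n) * (of_nat n * (A - B) $ i $ j) \<in> lie_part"
    by (rule lie_part_scale)
  moreover have "\<kappa> (1 / of_nat n) * of_nat n = 1"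
    using ij(2) by (simp add: scalar_mult[symmetric] scalar_one flip: scalar_of_nat)
  ultimately show ?thesis by (simp only: mult.assoc[symmetric] mult_1_left)
qed

section \<open>Existence and uniqueness of the factorization into two exponentials\<close>

definition inc_series :: "'g ser \<Rightarrow> 'r fps2" where
  "inc_series f = Abs_fps2 (\<lambda>i j. \<iota> (f i j))"

lemma inc_series_nth [simp]: "inc_series f $ i $ j = \<iota> (f i j)"
  by (simp add: inc_series_def)

lemma lie_series_inc_series: "lie_series (inc_series f)"
  by (simp add: lie_series_def inc_lie_part)

lemma order_ge_inc_series: "f 0 0 = 0 \<Longrightarrow> order_ge 1 (inc_series f)"
  by (simp add: order_ge_1_iff inc_zero)

abbreviation exp_inc :: "'g ser \<Rightarrow> 'r fps2" where
  "exp_inc f \<equiv> exp2 (inc_series f)"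

lemma exp_inc_nth_0_0: "f 0 0 = 0 \<Longrightarrow> exp_inc f $ 0 $ 0 = 1"
  by (rule exp2_nth_0_0[OF order_ge_inc_series])

text \<open>On the rectangle below \<open>(i, j)\<close> the factor \<open>exp_inc g\<close> is 1.
  This will settle the positions on the axes.\<close>

lemma exp_inc_commute:
  assumes "\<And>k l. k \<le> i \<Longrightarrow> l \<le> j \<Longrightarrow> g k l = 0" "f 0 0 = 0"
  shows "(exp_inc f * exp_inc g) $ i $ j = (exp_inc g * exp_inc f) $ i $ j"
proof -
  have "exp2 0 = 1"
  proof (rule fps2_eqI)
    fix i j
    have "exp2 0 $ i $ j = (\<Sum>n\<le>i + j. if n = 0 then (1 :: 'r fps2) $ i $ j else 0)"
      unfolding exp2_nth[OF order_ge_zero order_refl]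
      by (intro sum.cong refl) (simp add: power_0_left scalar_one)
    then show "exp2 0 $ i $ j = (1 :: 'r fps2) $ i $ j" by simp
  qed
  moreover have "agree_upto i j (inc_series g) 0"
    using assms(1) by (simp add: agree_upto_def inc_zero)
  ultimately have g: "agree_upto i j (exp_inc g) 1"
    using exp2_agree_upto[of i j "inc_series g" 0] assms(1)[of 0 0] order_ge_inc_series[of g] by simp
  have f: "agree_upto i j (exp_inc f) (exp_inc f)" by (simp add: agree_upto_def)
  show ?thesis
    using agree_upto_mult[OF f g] agree_upto_mult[OF g f] by (simp add: agree_upto_def)
qed

lemma inc_diff: "\<iota> x - \<iota> y - \<iota> (x - y) \<in> J"
  using inc_add[of "x - y" y] by (simp add: algebra_simps)

lemma inc_eqI: "\<iota> x - \<iota> y \<in> J \<Longrightarrow> x = y"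
  using J_diff[OF _ inc_diff, of "\<iota> x - \<iota> y" x y] inc_inj[of "x - y"] by simp

text \<open>Once all smaller positions agree, the two products differ at \<open>(i, j)\<close> by
  the sum of the differences of the exponents. By injectivity that sum is 0, so each difference lies
  in \<open>V i j\<close> and in \<open>W i j\<close>. The downward closed region \<open>P\<close>
  is the whole quadrant for uniqueness and a triangle for the coherence of partial
  solutions.\<close>

lemma exp_factors_unique:
  assumes V: "\<And>i j. subspace (V i j)" and W: "\<And>i j. subspace (W i j)" and VW: "\<And>i j. V i j \<inter> W i j \<subseteq> {0}"
    and P: "\<And>i j k l. P i j \<Longrightarrow> k \<le> i \<Longrightarrow> l \<le> j \<Longrightarrow> P k l"
    and a: "\<And>i j. P i j \<Longrightarrow> a i j \<in> V i j" "\<And>i j. P i j \<Longrightarrow> a' i j \<in> V i j"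
    and b: "\<And>i j. P i j \<Longrightarrow> b i j \<in> W i j" "\<And>i j. P i j \<Longrightarrow> b' i j \<in> W i j"
    and zero: "a 0 0 = 0" "a' 0 0 = 0" "b 0 0 = 0" "b' 0 0 = 0"
    and cong: "\<And>i j. P i j \<Longrightarrow> (exp_inc a * exp_inc b) $ i $ j - (exp_inc a' * exp_inc b') $ i $ j \<in> J"
    and "P i j"
  shows "a i j = a' i j \<and> b i j = b' i j"
  using \<open>P i j\<close>
proof (induction "i + j" arbitrary: i j rule: less_induct)
  case less
  show ?case
  proof (cases "(i, j) = (0, 0)")
    case True
    then show ?thesis using zero by simp
  next
    case False
    have IH: "a k l = a' k l \<and> b k l = b' k l" if "k \<le> i" "l \<le> j" "(k, l) \<noteq> (i, j)" for k l
      using that less.hyps[of k l] P[OF less.prems, of k l] by auto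
    then have "agree_below i j (inc_series a) (inc_series a')" "agree_below i j (inc_series b) (inc_series b')"
      by (auto simp: agree_below_def)
    from exp2_mult_nth_diff[OF this False] cong[OF less.prems]
    have "\<iota> (a i j) - \<iota> (a' i j) + (\<iota> (b i j) - \<iota> (b' i j)) \<in> J"
      by (simp add: order_ge_inc_series[unfolded One_nat_def] zero)
    moreover have "\<iota> (a i j - a' i j + (b i j - b' i j)) - (\<iota> (a i j) - \<iota> (a' i j) + (\<iota> (b i j) - \<iota> (b' i j)))
      = (\<iota> (a i j - a' i j + (b i j - b' i j)) - \<iota> (a i j - a' i j) - \<iota> (b i j - b' i j))
        - (\<iota> (a i j) - \<iota> (a' i j) - \<iota> (a i j - a' i j)) - (\<iota> (b i j) - \<iota> (b' i j) - \<iota> (b i j - b' i j))"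
      by simp
    moreover have "\<dots> \<in> J" by (rule J_diff[OF J_diff[OF inc_add inc_diff] inc_diff])
    ultimately have "\<iota> (a i j - a' i j + (b i j - b' i j)) \<in> J"
      using J_add by (metis diff_add_cancel)
    then have sum: "a i j - a' i j = b' i j - b i j"
      using inc_inj by (fastforce simp: algebra_simps)
    have "a i j - a' i j \<in> V i j" using a less.prems by (intro subspace_diff V)
    moreover have "a i j - a' i j \<in> W i j" unfolding sum using b less.prems by (intro subspace_diff W)
    ultimately have "a i j - a' i j = 0" using VW by blast
    then show ?thesis using sum by simp
  qed
qed

text \<open>On the axes nothing is split: \<open>a\<close> and \<open>b\<close> equal
  \<open>y\<close> and \<open>x\<close> there, and the congruence is \<open>comm\<close>. At an
  interior position of the next degree the discrepancy is a Lie element modulo \<open>J\<close>, and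
  its two components are added to \<open>a\<close> and \<open>b\<close>.\<close>

lemma exp_refactor_upto:
  assumes V: "\<And>i j. subspace (V i j)" and W: "\<And>i j. subspace (W i j)"
    and VW: "\<And>i j z. 0 < i \<Longrightarrow> 0 < j \<Longrightarrow> \<exists>v\<in>V i j. \<exists>w\<in>W i j. z = v + w"
    and zero: "x 0 0 = 0" "y 0 0 = 0"
    and axis: "\<And>i j. i = 0 \<or> j = 0 \<Longrightarrow> y i j \<in> V i j \<and> x i j \<in> W i j"
    and comm: "\<And>i j. i = 0 \<or> j = 0 \<Longrightarrow> (exp_inc x * exp_inc y) $ i $ j = (exp_inc y * exp_inc x) $ i $ j"
  shows "\<exists>a b. (\<forall>i j. a i j \<in> V i j \<and> b i j \<in> W i j) \<and> (\<forall>i j. i = 0 \<or> j = 0 \<longrightarrow> a i j = y i j \<and> b i j = x i j)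
    \<and> (\<forall>i j. i + j \<le> N \<longrightarrow> (exp_inc x * exp_inc y) $ i $ j - (exp_inc a * exp_inc b) $ i $ j \<in> J)"
proof (induction N)
  case 0
  \<comment> \<open>The values on the axes are final from the start; only interior coefficients are
    corrected later.\<close>
  let ?a = "\<lambda>i j. if i = 0 \<or> j = 0 then y i j else 0" and ?b = "\<lambda>i j. if i = 0 \<or> j = 0 then x i j else 0"
  have "(exp_inc x * exp_inc y) $ 0 $ 0 - (exp_inc ?a * exp_inc ?b) $ 0 $ 0 \<in> J"
    using zero by (simp add: exp_inc_nth_0_0 J_zero)
  then show ?case
    using axis V W by (intro exI[of _ ?a] exI[of _ ?b]) (auto intro: subspace_0)
next
  case (Suc N)
  then obtain a b where 1: "\<forall>i j. a i j \<in> V i j \<and> b i j \<in> W i j"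
    and 2: "\<forall>i j. i = 0 \<or> j = 0 \<longrightarrow> a i j = y i j \<and> b i j = x i j"
    and 3: "\<forall>i j. i + j \<le> N \<longrightarrow> (exp_inc x * exp_inc y) $ i $ j - (exp_inc a * exp_inc b) $ i $ j \<in> J"
    by (elim exE conjE) (rule that)
  from 1 have ab: "a i j \<in> V i j" "b i j \<in> W i j" for i j by simp_all
  from 2 have ax: "a i j = y i j \<and> b i j = x i j" if "i = 0 \<or> j = 0" for i j using that by blast
  from 3 have cong: "(exp_inc x * exp_inc y) $ i $ j - (exp_inc a * exp_inc b) $ i $ j \<in> J"
    if "i + j \<le> N" for i j using that by simp
  have zero': "a 0 0 = 0" "b 0 0 = 0" using ax zero by simp_all
  have "\<exists>v w. v \<in> V i j \<and> w \<in> W i j \<and>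
      (exp_inc x * exp_inc y - exp_inc a * exp_inc b) $ i $ j - \<iota> (v + w) \<in> J"
    if ij: "i + j = Suc N" "0 < i" "0 < j" for i j
  proof -
    obtain \<omega> where \<omega>: "lie_series \<omega>" "order_ge 1 \<omega>" "euler (exp_inc x * exp_inc y) = exp_inc x * exp_inc y * \<omega>"
      by (rule euler_exp2_mult[OF lie_series_inc_series lie_series_inc_series
            order_ge_inc_series[of x, OF zero(1)] order_ge_inc_series[of y, OF zero(2)]])
    obtain \<eta> where \<eta>: "lie_series \<eta>" "order_ge 1 \<eta>" "euler (exp_inc a * exp_inc b) = exp_inc a * exp_inc b * \<eta>"
      by (rule euler_exp2_mult[OF lie_series_inc_series lie_series_inc_series
            order_ge_inc_series[of a, OF zero'(1)] order_ge_inc_series[of b, OF zero'(2)]])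
    have "(exp_inc x * exp_inc y - exp_inc a * exp_inc b) $ i $ j \<in> lie_part"
    proof (rule leading_coeff_diff_lie_part[OF _ \<omega>(3,1,2) _ \<eta>(3,1,2)])
      show "(exp_inc x * exp_inc y) $ 0 $ 0 = 1" "(exp_inc a * exp_inc b) $ 0 $ 0 = 1"
        using zero zero' by (simp_all add: exp_inc_nth_0_0)
      show "(exp_inc x * exp_inc y - exp_inc a * exp_inc b) $ k $ l \<in> J" if "k + l < Suc N" for k l
        using cong[of k l] that by simp
    qed (use ij in auto)
    then obtain z where "(exp_inc x * exp_inc y - exp_inc a * exp_inc b) $ i $ j - \<iota> z \<in> J"
      by (auto simp: lie_part_def)
    then show ?thesis using VW[OF ij(2,3), of z] by blast
  qed
  then obtain v w where vw: "\<And>i j. i + j = Suc N \<Longrightarrow> 0 < i \<Longrightarrow> 0 < j \<Longrightarrow> v i j \<in> V i j \<and> w i j \<in> W i j \<and>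
      (exp_inc x * exp_inc y - exp_inc a * exp_inc b) $ i $ j - \<iota> (v i j + w i j) \<in> J"
    by metis
  let ?Q = "\<lambda>i j. i + j = Suc N \<and> 0 < i \<and> 0 < j"
  \<comment> \<open>All interior positions of degree \<open>Suc N\<close> are corrected at once:
    none of them lies in the rectangle below another.\<close>
  define a' where "a' = (\<lambda>i j. if ?Q i j then a i j + v i j else a i j)"
  define b' where "b' = (\<lambda>i j. if ?Q i j then b i j + w i j else b i j)"
  have mem: "a' i j \<in> V i j \<and> b' i j \<in> W i j" for i j
    using ab vw[of i j] by (auto simp: a'_def b'_def intro: subspace_add V W)
  have ax': "a' i j = y i j \<and> b' i j = x i j" if "i = 0 \<or> j = 0" for i j
    using ax[OF that] that by (auto simp: a'_def b'_def)
  have zero'': "a' 0 0 = 0" "b' 0 0 = 0" using ax' zero by simp_all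
  have "(exp_inc x * exp_inc y) $ i $ j - (exp_inc a' * exp_inc b') $ i $ j \<in> J" if ij: "i + j \<le> Suc N" for i j
  proof -
    consider "i = 0 \<or> j = 0" | "0 < i" "0 < j" "i + j \<le> N" | "0 < i" "0 < j" "i + j = Suc N"
      using ij by linarith
    then show ?thesis
    proof cases
      case 1
      have "agree_upto i j (inc_series a') (inc_series y)" "agree_upto i j (inc_series b') (inc_series x)"
        unfolding agree_upto_def using 1 ax' by auto
      then have "agree_upto i j (exp_inc a' * exp_inc b') (exp_inc y * exp_inc x)"
        by (intro agree_upto_mult exp2_agree_upto order_ge_inc_series zero zero'')
      then show ?thesis using comm[OF 1] J_zero by (simp add: agree_upto_def)
    next
      case 2
      have "agree_upto i j (inc_series a') (inc_series a)" "agree_upto i j (inc_series b') (inc_series b)"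
        unfolding agree_upto_def using 2 by (auto simp: a'_def b'_def)
      then have "agree_upto i j (exp_inc a' * exp_inc b') (exp_inc a * exp_inc b)"
        by (intro agree_upto_mult exp2_agree_upto order_ge_inc_series zero' zero'')
      then show ?thesis using cong[OF 2(3)] by (simp add: agree_upto_def)
    next
      case 3
      have "agree_below i j (inc_series a') (inc_series a)" "agree_below i j (inc_series b') (inc_series b)"
        unfolding agree_below_def using 3 by (auto simp: a'_def b'_def)
      from exp2_mult_nth_diff[OF this] have
        "(exp_inc a' * exp_inc b') $ i $ j - (exp_inc a * exp_inc b) $ i $ j =
          \<iota> (a i j + v i j) - \<iota> (a i j) + (\<iota> (b i j + w i j) - \<iota> (b i j))"
        using 3 by (simp add: order_ge_inc_series[unfolded One_nat_def] zero' zero'') (simp add: a'_def b'_def)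
      then have "(exp_inc x * exp_inc y) $ i $ j - (exp_inc a' * exp_inc b') $ i $ j =
          ((exp_inc x * exp_inc y - exp_inc a * exp_inc b) $ i $ j - \<iota> (v i j + w i j))
          + (\<iota> (v i j + w i j) - \<iota> (v i j) - \<iota> (w i j))
          - (\<iota> (a i j + v i j) - \<iota> (a i j) - \<iota> (v i j)) - (\<iota> (b i j + w i j) - \<iota> (b i j) - \<iota> (w i j))"
        by (simp add: algebra_simps)
      also have "\<dots> \<in> J"
        using vw[of i j] 3 by (intro J_diff[OF J_diff[OF J_add[OF _ inc_add] inc_add] inc_add]) simp
      finally show ?thesis .
    qed
  qed
  then show ?case using mem ax' by blast
qed

text \<open>The solutions up to degree \<open>N\<close> are chosen without regard to each other, but
  uniqueness on triangles makes them coherent. The diagonal, which takes each coefficient from the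
  solution for its own degree, is therefore a full solution.\<close>

lemma exp_refactor:
  assumes V: "\<And>i j. subspace (V i j)" and W: "\<And>i j. subspace (W i j)" and disj: "\<And>i j. V i j \<inter> W i j \<subseteq> {0}"
    and VW: "\<And>i j z. 0 < i \<Longrightarrow> 0 < j \<Longrightarrow> \<exists>v\<in>V i j. \<exists>w\<in>W i j. z = v + w"
    and zero: "x 0 0 = 0" "y 0 0 = 0"
    and axis: "\<And>i j. i = 0 \<or> j = 0 \<Longrightarrow> y i j \<in> V i j \<and> x i j \<in> W i j"
    and comm: "\<And>i j. i = 0 \<or> j = 0 \<Longrightarrow> (exp_inc x * exp_inc y) $ i $ j = (exp_inc y * exp_inc x) $ i $ j"
  obtains a b where "\<And>i j. a i j \<in> V i j" "\<And>i j. b i j \<in> W i j"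
    "\<And>i j. i = 0 \<or> j = 0 \<Longrightarrow> a i j = y i j \<and> b i j = x i j"
    "\<And>i j. (exp_inc x * exp_inc y) $ i $ j - (exp_inc a * exp_inc b) $ i $ j \<in> J"
proof -
  define P where "P = (\<lambda>N a b. (\<forall>i j. a i j \<in> V i j \<and> b i j \<in> W i j) \<and> (\<forall>i j. i = 0 \<or> j = 0 \<longrightarrow> a i j = y i j \<and> b i j = x i j)
    \<and> (\<forall>i j. i + j \<le> N \<longrightarrow> (exp_inc x * exp_inc y) $ i $ j - (exp_inc a * exp_inc b) $ i $ j \<in> J))"
  have "\<exists>a b. P N a b" for N
    unfolding P_def by (rule exp_refactor_upto[OF V W VW zero axis comm])
  then obtain A B where P: "\<And>N. P N (A N) (B N)" by metis
  have AB: "A N i j \<in> V i j" "B N i j \<in> W i j" for N i j using P[of N] unfolding P_def by blast+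
  have ax: "A N i j = y i j \<and> B N i j = x i j" if "i = 0 \<or> j = 0" for N i j
    using P[of N] that unfolding P_def by blast
  have cong: "(exp_inc x * exp_inc y) $ i $ j - (exp_inc (A N) * exp_inc (B N)) $ i $ j \<in> J"
    if "i + j \<le> N" for N i j using P[of N] that unfolding P_def by blast
  have zero': "A N 0 0 = 0" "B N 0 0 = 0" for N using ax[of 0 0] zero by simp_all
  have coh: "A M k l = A N k l \<and> B M k l = B N k l" if "k + l \<le> M" "M \<le> N" for k l M N
  proof (rule exp_factors_unique[OF V W disj, of "\<lambda>k l. k + l \<le> M"])
    fix i j assume ij: "i + j \<le> M"
    have "((exp_inc x * exp_inc y) $ i $ j - (exp_inc (A N) * exp_inc (B N)) $ i $ j)
        - ((exp_inc x * exp_inc y) $ i $ j - (exp_inc (A M) * exp_inc (B M)) $ i $ j) \<in> J"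
      using ij that(2) by (intro J_diff[OF cong cong]) simp_all
    then show "(exp_inc (A M) * exp_inc (B M)) $ i $ j - (exp_inc (A N) * exp_inc (B N)) $ i $ j \<in> J"
      by simp
  qed (use that AB zero' in auto)
  define a where "a = (\<lambda>i j. A (i + j) i j)"
  define b where "b = (\<lambda>i j. B (i + j) i j)"
  have zero'': "a 0 0 = 0" "b 0 0 = 0" using zero' by (simp_all add: a_def b_def)
  show ?thesis
  proof (rule that[of a b])
    fix i j
    have "a k l = A (i + j) k l \<and> b k l = B (i + j) k l" if "k \<le> i" "l \<le> j" for k l
      unfolding a_def b_def using that by (intro coh) auto
    then have "agree_upto i j (inc_series a) (inc_series (A (i + j)))" "agree_upto i j (inc_series b) (inc_series (B (i + j)))"
      unfolding agree_upto_def by simp_all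
    then have "agree_upto i j (exp_inc a * exp_inc b) (exp_inc (A (i + j)) * exp_inc (B (i + j)))"
      by (intro agree_upto_mult exp2_agree_upto order_ge_inc_series zero' zero'')
    then show "(exp_inc x * exp_inc y) $ i $ j - (exp_inc a * exp_inc b) $ i $ j \<in> J"
      using cong[of i j "i + j"] by (simp add: agree_upto_def)
  qed (use AB ax in \<open>simp_all add: a_def b_def\<close>)
qed

end

section \<open>Transfer to the enveloping algebra\<close>

text \<open>As \<open>gen 0\<close> is a nonzero element of the free algebra, it is replaced by \<open>0\<close> to make the
  coefficientwise image of a series without constant term a series without constant term.\<close>

definition (in lie_algebra) envelope_inc :: "'g \<Rightarrow> ('k, 'g) free_alg" where
  "envelope_inc x = (if x = 0 then 0 else gen x)"

lemma const_mult_commute: "const c * a = a * const c" for a :: "('k::field, 'g) free_alg"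
proof -
  have "const c * a - a * const c = 0"
    by (rule additive_eq_0_free_alg[where \<phi> = "\<lambda>a. const c * a - a * const c"])
      (simp_all add: distrib_left distrib_right const_def mult_single plus_free_word_def mult.commute)
  then show ?thesis by simp
qed

lemma const_single_zero: "const c = Poly_Mapping.single 0 c"
  by (simp add: const_def zero_free_word_def)

lemma ex1_bijection:
  assumes C: "\<And>x. x \<in> D \<Longrightarrow> \<exists>!y. y \<in> C \<and> R x y" and D: "\<And>y. y \<in> C \<Longrightarrow> \<exists>!x. x \<in> D \<and> R x y"
  shows "\<exists>!f. f \<in> extensional D \<and> bij_betw f D C \<and> (\<forall>x\<in>D. R x (f x))"
proof (rule ex1I)
  define f where "f = (\<lambda>x\<in>D. THE y. y \<in> C \<and> R x y)"
  have f: "f x \<in> C \<and> R x (f x)" if "x \<in> D" for x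
    using theI'[OF C[OF that]] that by (simp add: f_def)
  have "bij_betw f D C"
    unfolding bij_betw_def
  proof (intro conjI inj_onI equalityI subsetI)
    show "x = x'" if "x \<in> D" "x' \<in> D" "f x = f x'" for x x'
      using f[of x] f[of x'] D[of "f x"] that by auto
    show "y \<in> f ` D" if y: "y \<in> C" for y
    proof -
      obtain x where x: "x \<in> D" "R x y" using D[OF y] by blast
      then have "f x = y" using f[OF x(1)] C[OF x(1)] y by blast
      then show ?thesis using x by blast
    qed
  qed (use f in auto)
  then show "f \<in> extensional D \<and> bij_betw f D C \<and> (\<forall>x\<in>D. R x (f x))"
    using f by (simp add: f_def)
  fix g assume g: "g \<in> extensional D \<and> bij_betw g D C \<and> (\<forall>x\<in>D. R x (g x))"
  show "g = f"
  proof (rule extensionalityI[of _ D])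
    show "f \<in> extensional D" by (simp add: f_def)
    show "g x = f x" if "x \<in> D" for x
      using f[OF that] g C[OF that] that bij_betw_apply[of g D C x] by blast
  qed (use g in simp)
qed

locale split_lie_algebra_char_0 = split_lie_algebra scale bracket gm gp
  for scale :: "'k::field_char_0 \<Rightarrow> 'g::ab_group_add \<Rightarrow> 'g" and bracket :: "'g \<Rightarrow> 'g \<Rightarrow> 'g" and gm gp :: "'g set"
begin

abbreviation U where "U \<equiv> envelope scale bracket"
abbreviation cl where "cl \<equiv> envelope_class scale bracket"
abbreviation J where "J \<equiv> envelope_ideal scale bracket"

lemma envelope_ideal_closed:
  shows "0 \<in> J" and "a \<in> J \<Longrightarrow> b \<in> J \<Longrightarrow> a + b \<in> J" and "a \<in> J \<Longrightarrow> - a \<in> J"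
    and "a \<in> J \<Longrightarrow> r * a \<in> J" and "a \<in> J \<Longrightarrow> a * r \<in> J"
proof -
  interpret I: ideal J "ring_of_type_algebra :: ('k, 'g) free_alg ring" by (rule ideal_envelope_ideal)
  show "0 \<in> J" "a \<in> J \<Longrightarrow> b \<in> J \<Longrightarrow> a + b \<in> J"
    using additive_subgroup.zero_closed[OF I.additive_subgroup_axioms]
      additive_subgroup.a_closed[OF I.additive_subgroup_axioms, of a b] by (simp_all add: ring_of_type_algebra_def)
  have left: "r * a \<in> J" if "a \<in> J" for a r
    using I.I_l_closed[OF that, of r] by (simp add: ring_of_type_algebra_def)
  then show "a \<in> J \<Longrightarrow> r * a \<in> J" .
  show "a \<in> J \<Longrightarrow> a * r \<in> J"
    using I.I_r_closed[of a r] by (simp add: ring_of_type_algebra_def)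
  show "a \<in> J \<Longrightarrow> - a \<in> J" using left[of a "- 1"] by simp
qed

lemma envelope_relations:
  shows "gen (x + y) - gen x - gen y \<in> J" and "gen (scale c x) - const c * gen x \<in> J"
    and "gen x * gen y - gen y * gen x - gen (bracket x y) \<in> J"
proof -
  have "envelope_rels scale bracket \<subseteq> J"
    unfolding envelope_ideal_def
    using ring.genideal_self[OF ring_free_alg, of "envelope_rels scale bracket"]
    by (auto simp: ring_of_type_algebra_def)
  then show "gen (x + y) - gen x - gen y \<in> J" "gen (scale c x) - const c * gen x \<in> J"
    "gen x * gen y - gen y * gen x - gen (bracket x y) \<in> J"
    unfolding envelope_rels_def by blast+
qed

text \<open>Only \<open>gen 0\<close> is in question, and the additivity relation for
  \<open>0 + 0\<close> is \<open>- gen 0\<close>.\<close>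

lemma gen_envelope_inc: "gen x - envelope_inc x \<in> J"
proof (cases "x = 0")
  case True
  from envelope_ideal_closed(3)[OF envelope_relations(1)[of 0 0]] show ?thesis using True by (simp add: envelope_inc_def)
qed (simp add: envelope_inc_def envelope_ideal_closed)

text \<open>Modulo \<open>J\<close> the maps \<open>gen\<close> and \<open>envelope_inc\<close>
  agree, so each defining relation carries over after subtracting these differences; injectivity is
  \<open>gen_in_envelope_ideal\<close>.\<close>

sublocale env: lie_envelope scale bracket const envelope_inc J
proof
  have diff: "a - b \<in> J" if "a \<in> J" "b \<in> J" for a b
    using envelope_ideal_closed(2)[OF that(1) envelope_ideal_closed(3)[OF that(2)]] by simp
  note inc = gen_envelope_inc
  show "const 1 = (1 :: ('k, 'g) free_alg)" by (simp add: const_single_zero)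
  show "const (c + d) = (const c + const d :: ('k, 'g) free_alg)" for c d by (simp add: const_def single_add)
  show "const (c * d) = (const c * const d :: ('k, 'g) free_alg)" for c d by (simp add: const_single_zero mult_single)
  show "const c * a = a * const c" for c and a :: "('k, 'g) free_alg" by (rule const_mult_commute)
  show "envelope_inc 0 = 0" by (simp add: envelope_inc_def)
  show "envelope_inc (x + y) - envelope_inc x - envelope_inc y \<in> J" for x y
    using diff[OF envelope_relations(1)[of x y] diff[OF diff[OF inc inc] inc, of "x + y" x y]]
    by (simp add: algebra_simps)
  show "envelope_inc (scale c x) - const c * envelope_inc x \<in> J" for c x
    using diff[OF envelope_relations(2)[of c x] diff[OF inc envelope_ideal_closed(4)[OF inc], of "scale c x" "const c" x]]
    by (simp add: right_diff_distrib)
  show "envelope_inc x * envelope_inc y - envelope_inc y * envelope_inc x - envelope_inc (bracket x y) \<in> J" for x y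
  proof -
    let ?d = "\<lambda>x. gen x - envelope_inc x"
    have d: "?d x * gen y + envelope_inc x * ?d y \<in> J" for x y
      by (rule envelope_ideal_closed(2)[OF envelope_ideal_closed(5)[OF inc] envelope_ideal_closed(4)[OF inc]])
    from diff[OF envelope_relations(3)[of x y] diff[OF diff[OF d[of x y] d[of y x]] inc[of "bracket x y"]]]
    show ?thesis by (simp add: algebra_simps)
  qed
  show "x = 0" if "envelope_inc x \<in> J" for x
    using gen_in_envelope_ideal envelope_ideal_closed(2)[OF inc that, of x] by simp
qed (auto intro: envelope_ideal_closed)

section \<open>Passage from congruences to equalities in the quotient ring\<close>

lemma cl_closed [simp]: "cl a \<in> carrier U"
  and cl_mult: "cl a \<otimes>\<^bsub>U\<^esub> cl b = cl (a * b)"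
  and cl_add: "cl a \<oplus>\<^bsub>U\<^esub> cl b = cl (a + b)"
  and cl_one: "\<one>\<^bsub>U\<^esub> = cl 1"
  using ring_hom_closed[OF envelope_class_hom[of scale bracket], of a] ring_hom_mult[OF envelope_class_hom[of scale bracket], of a b]
    ring_hom_add[OF envelope_class_hom[of scale bracket], of a b] ring_hom_one[OF envelope_class_hom[of scale bracket]]
  by (simp_all add: ring_of_type_algebra_def)

lemma cl_zero: "\<zero>\<^bsub>U\<^esub> = cl 0"
  using ring_hom_zero[OF envelope_class_hom[of scale bracket] ring_free_alg ring_envelope]
  by (simp add: ring_of_type_algebra_def)

lemma cl_eq_iff: "cl a = cl b \<longleftrightarrow> a - b \<in> J"
proof -
  have "cl a = (\<lambda>h. h + a) ` J" for a
    by (auto simp: envelope_class_def a_r_coset_def r_coset_def ring_of_type_algebra_def)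
  then show ?thesis
  proof (intro iffI, goal_cases)
    case 1
    then have "0 + a \<in> (\<lambda>h. h + b) ` J" using envelope_ideal_closed(1) by (metis imageI)
    then show ?case by auto
  next
    case 2
    have "(\<lambda>h. h + a) ` J = (\<lambda>h. h + b) ` J"
    proof (intro equalityI subsetI)
      fix z assume "z \<in> (\<lambda>h. h + a) ` J"
      then obtain h where "h \<in> J" "z = (h + (a - b)) + b" by auto
      then show "z \<in> (\<lambda>h. h + b) ` J" using envelope_ideal_closed(2)[OF _ 2(2)] by blast
    next
      fix z assume "z \<in> (\<lambda>h. h + b) ` J"
      then obtain h where "h \<in> J" "z = (h + - (a - b)) + a" by auto
      then show "z \<in> (\<lambda>h. h + a) ` J"
        using envelope_ideal_closed(2)[OF _ envelope_ideal_closed(3)[OF 2(2)]] by blast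
    qed
    then show ?case using 2 by simp
  qed
qed

lemma cl_sum: "finite S \<Longrightarrow> cl (\<Sum>x\<in>S. f x) = (\<Oplus>\<^bsub>U\<^esub>x\<in>S. cl (f x))"
proof (induction S rule: finite_induct)
  case empty
  interpret R: ring U by (rule ring_envelope)
  show ?case by (simp add: cl_zero)
next
  case (insert x S)
  interpret R: ring U by (rule ring_envelope)
  show ?case using insert by (simp add: cl_add[symmetric])
qed

definition cl_series :: "('k, 'g) free_alg fps2 \<Rightarrow> ('k, 'g) free_alg set ser" where
  "cl_series F = (\<lambda>i j. cl (F $ i $ j))"

lemma cl_series_mult: "cl_series F \<otimes>\<^bsub>series_ring U\<^esub> cl_series G = cl_series (F * G)"
  by (simp add: series_ring_def cl_series_def fps2_mult_nth cl_sum cl_mult)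

lemma cl_series_power: "cl_series F [^]\<^bsub>series_ring U\<^esub> n = cl_series (F ^ n)" for n :: nat
proof (induction n)
  case 0
  show ?case
    by (simp add: nat_pow_def series_ring_def cl_series_def fun_eq_iff cl_one cl_zero)
next
  case (Suc n)
  have "cl_series F [^]\<^bsub>series_ring U\<^esub> Suc n = (cl_series F [^]\<^bsub>series_ring U\<^esub> n) \<otimes>\<^bsub>series_ring U\<^esub> cl_series F"
    by (simp add: nat_pow_def)
  then show ?case by (simp only: Suc.IH cl_series_mult power_Suc2)
qed

lemma series_exp_eq:
  assumes "f 0 0 = 0"
  shows "series_exp scale bracket f = cl_series (env.exp_inc f)"
proof -
  have "cl (gen x) = cl (envelope_inc x)" for x by (simp add: cl_eq_iff gen_envelope_inc)
  then have m: "map_series (\<lambda>x. cl (gen x)) f = cl_series (env.inc_series f)"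
    by (simp add: map_series_def cl_series_def)
  have "series_exp scale bracket f i j = cl_series (env.exp_inc f) i j" for i j
    unfolding series_exp_def Let_def m cl_series_power
    using env.exp2_nth[OF env.order_ge_inc_series order_refl, of f i j] assms
    by (simp add: cl_series_def cl_mult cl_sum)
  then show ?thesis by (simp add: fun_eq_iff)
qed

definition exp_cong :: "'g ser \<times> 'g ser \<Rightarrow> 'g ser \<times> 'g ser \<Rightarrow> bool" where
  "exp_cong p q \<longleftrightarrow> (\<forall>i j. (env.exp_inc (fst p) * env.exp_inc (snd p)) $ i $ j
     - (env.exp_inc (fst q) * env.exp_inc (snd q)) $ i $ j \<in> J)"

lemma series_exp_mult_eq_iff:
  assumes "x 0 0 = 0" "y 0 0 = 0" "a 0 0 = 0" "b 0 0 = 0"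
  shows "series_exp scale bracket x \<otimes>\<^bsub>series_ring U\<^esub> series_exp scale bracket y =
    series_exp scale bracket a \<otimes>\<^bsub>series_ring U\<^esub> series_exp scale bracket b \<longleftrightarrow> exp_cong (x, y) (a, b)"
  by (simp add: series_exp_eq assms cl_series_mult) (simp add: cl_series_def fun_eq_iff cl_eq_iff exp_cong_def)

definition families :: "(nat \<Rightarrow> nat \<Rightarrow> 'g set) \<Rightarrow> 'g ser set" where
  "families V = {f. \<forall>i j. f i j \<in> V i j}"

text \<open>Divisibility by \<open>s\<close> becomes a condition on each coefficient, so the domain
  and codomain take the form of the position-dependent subspaces in
  \<open>exp_refactor\<close>.\<close>

definition minus_coeffs :: "nat \<Rightarrow> nat \<Rightarrow> 'g set" where "minus_coeffs i j = (if i = 0 then {0} else gm)"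
definition plus_coeffs :: "nat \<Rightarrow> nat \<Rightarrow> 'g set" where "plus_coeffs i j = (if j = 0 then {0} else gp)"

lemma zero_minus: "0 \<in> gm" and zero_plus: "0 \<in> gp"
  using subspace_minus subspace_plus subspace_0 by blast+

lemma mul_s_image: "mul_s ` series gm = families minus_coeffs"
proof (intro equalityI subsetI)
  fix f assume "f \<in> families minus_coeffs"
  then have f: "f i j \<in> minus_coeffs i j" for i j by (simp add: families_def)
  have "f = mul_s (\<lambda>i j. f (Suc i) j)"
    using f[of 0] by (auto simp: mul_s_def minus_coeffs_def fun_eq_iff split: nat.split)
  moreover have "(\<lambda>i j. f (Suc i) j) \<in> series gm"
    using f[of "Suc _"] by (simp add: series_def minus_coeffs_def)
  ultimately show "f \<in> mul_s ` series gm" by (rule image_eqI)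
qed (auto simp: mul_s_def series_def families_def minus_coeffs_def split: nat.split)

lemma mul_t_image: "mul_t ` series gp = families plus_coeffs"
proof (intro equalityI subsetI)
  fix f assume "f \<in> families plus_coeffs"
  then have f: "f i j \<in> plus_coeffs i j" for i j by (simp add: families_def)
  have "f = mul_t (\<lambda>i j. f i (Suc j))"
    using f[of _ 0] by (auto simp: mul_t_def plus_coeffs_def fun_eq_iff split: nat.split)
  moreover have "(\<lambda>i j. f i (Suc j)) \<in> series gp"
    using f[of _ "Suc _"] by (simp add: series_def plus_coeffs_def)
  ultimately show "f \<in> mul_t ` series gp" by (rule image_eqI)
qed (auto simp: mul_t_def series_def families_def plus_coeffs_def split: nat.split)

lemma families_axis: "f \<in> families minus_coeffs \<Longrightarrow> f 0 j = 0" "f \<in> families plus_coeffs \<Longrightarrow> f i 0 = 0"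
  unfolding families_def minus_coeffs_def plus_coeffs_def by (auto dest: spec[of _ 0] spec2[of _ i 0])

text \<open>Both orders are covered at once, one for the map and one for its inverse. The axis
  values in the second claim are what the lowest order terms are read off from.\<close>

lemma exp_refactor_families:
  assumes VW: "(V, W) = (minus_coeffs, plus_coeffs) \<or> (V, W) = (plus_coeffs, minus_coeffs)" and x: "x \<in> families W" and y: "y \<in> families V"
  shows "\<exists>!q. q \<in> families V \<times> families W \<and> exp_cong (x, y) q" (is ?ex1)
    and "\<exists>a\<in>families V. \<exists>b\<in>families W. exp_cong (x, y) (a, b) \<and>
      (\<forall>i j. i = 0 \<or> j = 0 \<longrightarrow> a i j = y i j \<and> b i j = x i j)" (is ?ex)
proof -
  have xy: "x i j \<in> W i j" "y i j \<in> V i j" for i j using x y by (simp_all add: families_def)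
  have sub: "subspace (minus_coeffs i j)" "subspace (plus_coeffs i j)" for i j
    using subspace_minus subspace_plus by (simp_all add: minus_coeffs_def plus_coeffs_def subspace_single_0)
  then have V: "subspace (V i j)" and W: "subspace (W i j)" for i j using VW by auto
  have disj: "V i j \<inter> W i j \<subseteq> {0}" for i j
  proof -
    have "minus_coeffs i j \<inter> plus_coeffs i j \<subseteq> {0}" using decomp_inter by (simp add: minus_coeffs_def plus_coeffs_def)
    then show ?thesis using VW by (elim disjE) (simp_all add: Int_commute)
  qed
  have dec: "\<exists>v\<in>V i j. \<exists>w\<in>W i j. z = v + w" if "0 < i" "0 < j" for i j z
  proof -
    have "V i j = gm \<and> W i j = gp \<or> V i j = gp \<and> W i j = gm" using VW that by (elim disjE) (simp_all add: minus_coeffs_def plus_coeffs_def)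
    then show ?thesis using decomp_sum[of z] by (metis add.commute)
  qed
  have zero: "f 0 0 = 0" if "f \<in> families V \<union> families W" for f using VW that by (elim disjE) (auto simp: families_axis)
  \<comment> \<open>For a position on an axis the rectangle below it is a segment of that axis,
    along which one of the two exponents vanishes.\<close>
  have van: "(\<forall>k l. k \<le> i \<longrightarrow> l \<le> j \<longrightarrow> x k l = 0) \<or> (\<forall>k l. k \<le> i \<longrightarrow> l \<le> j \<longrightarrow> y k l = 0)"
    if "i = 0 \<or> j = 0" for i j
    using VW that by (elim disjE) (use x y in \<open>simp_all add: families_axis\<close>)
  have comm: "(env.exp_inc x * env.exp_inc y) $ i $ j = (env.exp_inc y * env.exp_inc x) $ i $ j"
    if "i = 0 \<or> j = 0" for i j
    using van[OF that]
  proof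
    assume "\<forall>k l. k \<le> i \<longrightarrow> l \<le> j \<longrightarrow> x k l = 0"
    then show ?thesis using zero y by (intro env.exp_inc_commute[symmetric]) auto
  next
    assume "\<forall>k l. k \<le> i \<longrightarrow> l \<le> j \<longrightarrow> y k l = 0"
    then show ?thesis using zero x by (intro env.exp_inc_commute) auto
  qed
  have axis: "y i j \<in> V i j \<and> x i j \<in> W i j" for i j using xy by simp
  have z: "x 0 0 = 0" "y 0 0 = 0" using zero x y by auto
  obtain a b where ab: "\<And>i j. a i j \<in> V i j" "\<And>i j. b i j \<in> W i j"
    and ax: "\<And>i j. i = 0 \<or> j = 0 \<Longrightarrow> a i j = y i j \<and> b i j = x i j"
    and cong: "\<And>i j. (env.exp_inc x * env.exp_inc y) $ i $ j - (env.exp_inc a * env.exp_inc b) $ i $ j \<in> J"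
    by (rule env.exp_refactor[OF V W disj dec z axis comm]) (assumption | rule that)+
  have abf: "a \<in> families V" "b \<in> families W" using ab by (simp_all add: families_def)
  show ?ex
    using abf cong ax by (intro bexI[of _ a] bexI[of _ b]) (simp_all add: exp_cong_def)
  show ?ex1
  proof (rule ex1I[of _ "(a, b)"])
    show "(a, b) \<in> families V \<times> families W \<and> exp_cong (x, y) (a, b)" using abf cong by (simp add: exp_cong_def)
    fix q assume q: "q \<in> families V \<times> families W \<and> exp_cong (x, y) q"
    obtain a' b' where e: "q = (a', b')" by (cases q)
    have mem: "a' i j \<in> V i j" "b' i j \<in> W i j" for i j using q e by (auto simp: families_def)
    have cong': "(env.exp_inc x * env.exp_inc y) $ i $ j - (env.exp_inc a' * env.exp_inc b') $ i $ j \<in> J" for i j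
      using q e by (simp add: exp_cong_def)
    have d: "(env.exp_inc a' * env.exp_inc b') $ i $ j - (env.exp_inc a * env.exp_inc b) $ i $ j \<in> J" for i j
      using env.J_diff[OF cong[of i j] cong'[of i j]] by simp
    have "a' 0 0 = 0" "a 0 0 = 0" "b' 0 0 = 0" "b 0 0 = 0" using zero abf q e by auto
    then have "a' i j = a i j \<and> b' i j = b i j" for i j
      using env.exp_factors_unique[of V W "\<lambda>_ _. True" a' a b' b i j] V W disj mem ab d by simp
    then show "q = (a, b)" by (simp add: e fun_eq_iff)
  qed
qed

lemma proj_minus: "v \<in> gm \<Longrightarrow> w \<in> gp \<Longrightarrow> proj_along gm gp (v + w) = v"
  and proj_plus: "v \<in> gm \<Longrightarrow> w \<in> gp \<Longrightarrow> proj_along gp gm (v + w) = w"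
proof -
  have uniq: "v = v' \<and> w = w'" if "v \<in> gm" "w \<in> gp" "v' \<in> gm" "w' \<in> gp" "v + w = v' + w'" for v w v' w'
  proof -
    have e: "v - v' = w' - w" using that(5) by (simp add: algebra_simps)
    have "v - v' \<in> gm" "w' - w \<in> gp"
      using that subspace_diff subspace_minus subspace_plus by blast+
    then have "v - v' = 0" using e decomp_inter by (metis IntI singletonD)
    then show ?thesis using e by simp
  qed
  show "proj_along gm gp (v + w) = v" if "v \<in> gm" "w \<in> gp"
    unfolding proj_along_def using that uniq by (intro the_equality) blast+
  show "proj_along gp gm (v + w) = w" if "v \<in> gm" "w \<in> gp"
    unfolding proj_along_def
  proof (rule the_equality)
    show "w \<in> gp \<and> (\<exists>v'\<in>gm. v + w = w + v')" using that by (auto simp: add.commute)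
    fix w' assume "w' \<in> gp \<and> (\<exists>v'\<in>gm. v + w = w' + v')"
    then show "w' = w" using uniq[OF that, of _ w'] by (auto simp: add.commute)
  qed
qed

lemma families_mem: "f \<in> families minus_coeffs \<Longrightarrow> f i j \<in> gm" "f \<in> families plus_coeffs \<Longrightarrow> f i j \<in> gp"
proof -
  have "minus_coeffs i j \<subseteq> gm" "plus_coeffs i j \<subseteq> gp" using zero_minus zero_plus by (simp_all add: minus_coeffs_def plus_coeffs_def)
  then show "f \<in> families minus_coeffs \<Longrightarrow> f i j \<in> gm" "f \<in> families plus_coeffs \<Longrightarrow> f i j \<in> gp" unfolding families_def by blast+
qed

lemma pi_pair_sum:
  assumes "z \<in> families minus_coeffs \<times> families plus_coeffs"
  shows "pi_minus gm gp (pair_sum z) = fst z" "pi_plus gm gp (pair_sum z) = snd z"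
  using assms families_mem
  by (auto simp: pi_minus_def pi_plus_def map_series_def pair_sum_def proj_minus proj_plus)

text \<open>The values of \<open>\<Psi>\<close> lie in the codomain, so projecting the sum of a pair
  returns its two components.\<close>

lemma is_factorization_bijection_iff:
  "is_factorization_bijection scale bracket gm gp \<Psi> \<longleftrightarrow>
    \<Psi> \<in> extensional (families plus_coeffs \<times> families minus_coeffs) \<and> bij_betw \<Psi> (families plus_coeffs \<times> families minus_coeffs) (families minus_coeffs \<times> families plus_coeffs) \<and>
    (\<forall>p\<in>families plus_coeffs \<times> families minus_coeffs. exp_cong p (\<Psi> p))"
proof -
  have "series_exp scale bracket x \<otimes>\<^bsub>series_ring U\<^esub> series_exp scale bracket y =
      series_exp scale bracket (pi_minus gm gp (pair_sum (\<Psi> (x, y))))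
        \<otimes>\<^bsub>series_ring U\<^esub> series_exp scale bracket (pi_plus gm gp (pair_sum (\<Psi> (x, y))))
      \<longleftrightarrow> exp_cong (x, y) (\<Psi> (x, y))"
    if "bij_betw \<Psi> (families plus_coeffs \<times> families minus_coeffs) (families minus_coeffs \<times> families plus_coeffs)" "x \<in> families plus_coeffs" "y \<in> families minus_coeffs" for x y
  proof -
    have z: "\<Psi> (x, y) \<in> families minus_coeffs \<times> families plus_coeffs" using bij_betw_apply[OF that(1)] that(2,3) by blast
    then have "fst (\<Psi> (x, y)) 0 0 = 0" "snd (\<Psi> (x, y)) 0 0 = 0" by (auto simp: mem_Times_iff families_axis)
    then show ?thesis
      using series_exp_mult_eq_iff[of x y "fst (\<Psi> (x, y))" "snd (\<Psi> (x, y))"]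
      by (simp add: pi_pair_sum[OF z] families_axis that)
  qed
  then show ?thesis
    unfolding is_factorization_bijection_def mul_s_image[symmetric] mul_t_image[symmetric]
    by (auto simp: ball_simps)
qed

lemma exp_cong_sym: "exp_cong p q \<longleftrightarrow> exp_cong q p"
  unfolding exp_cong_def by (metis env.J_neg minus_diff_eq)

lemma ex1_factorization_bijection: "\<exists>!\<Psi>. is_factorization_bijection scale bracket gm gp \<Psi>"
  unfolding is_factorization_bijection_iff
proof (rule ex1_bijection)
  fix p assume "p \<in> families plus_coeffs \<times> families minus_coeffs"
  then show "\<exists>!q. q \<in> families minus_coeffs \<times> families plus_coeffs \<and> exp_cong p q"
    using exp_refactor_families(1)[of minus_coeffs plus_coeffs "fst p" "snd p"] by (simp add: mem_Times_iff)
next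
  fix q assume "q \<in> families minus_coeffs \<times> families plus_coeffs"
  then show "\<exists>!p. p \<in> families plus_coeffs \<times> families minus_coeffs \<and> exp_cong p q"
    using exp_refactor_families(1)[of plus_coeffs minus_coeffs "fst q" "snd q"] by (simp add: mem_Times_iff exp_cong_sym[of _ q])
qed

text \<open>In the coefficient of \<open>s t\<close> the linear terms \<open>x 0 1\<close> and
  \<open>y 1 0\<close> are multiplied in opposite orders on the two sides; modulo \<open>J\<close>
  the difference of these products is the bracket.\<close>

lemma factor_coeff_1_1:
  assumes x: "x \<in> families plus_coeffs" and y: "y \<in> families minus_coeffs" and a: "a \<in> families minus_coeffs" and b: "b \<in> families plus_coeffs"
    and cong: "exp_cong (x, y) (a, b)" and ax: "a 1 0 = y 1 0" "b 0 1 = x 0 1"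
  shows "a 1 1 + b 1 1 = y 1 1 + x 1 1 + bracket (x 0 1) (y 1 0)"
proof -
  let ?i = envelope_inc
  have z: "x 0 0 = 0" "x 1 0 = 0" "y 0 0 = 0" "y 0 1 = 0" "a 0 0 = 0" "a 0 1 = 0" "b 0 0 = 0" "b 1 0 = 0"
    using x y a b by (simp_all add: families_axis)
  have "(env.exp_inc x * env.exp_inc y) $ 1 $ 1 = ?i (x 1 1) + ?i (y 1 1) + ?i (x 0 1) * ?i (y 1 0)"
    by (subst env.exp2_mult_nth_1_1) (simp_all only: env.order_ge_inc_series env.inc_series_nth z env.inc_zero
        mult_zero_left mult_zero_right add_0_right simp_thms)
  moreover have "(env.exp_inc a * env.exp_inc b) $ 1 $ 1 = ?i (a 1 1) + ?i (b 1 1) + ?i (y 1 0) * ?i (x 0 1)"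
    by (subst env.exp2_mult_nth_1_1) (simp_all only: env.order_ge_inc_series env.inc_series_nth z ax env.inc_zero
        mult_zero_left mult_zero_right add_0_right simp_thms)
  moreover have "(env.exp_inc x * env.exp_inc y) $ 1 $ 1 - (env.exp_inc a * env.exp_inc b) $ 1 $ 1 \<in> J"
    using cong unfolding exp_cong_def fst_conv snd_conv by blast
  ultimately have 1: "?i (x 1 1) + ?i (y 1 1) + ?i (x 0 1) * ?i (y 1 0)
      - (?i (a 1 1) + ?i (b 1 1) + ?i (y 1 0) * ?i (x 0 1)) \<in> J" by (simp only:)
  let ?w = "bracket (x 0 1) (y 1 0)"
  have "(?i (x 1 1) + ?i (y 1 1) + ?i (x 0 1) * ?i (y 1 0) - (?i (a 1 1) + ?i (b 1 1) + ?i (y 1 0) * ?i (x 0 1)))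
      - (?i (x 0 1) * ?i (y 1 0) - ?i (y 1 0) * ?i (x 0 1) - ?i ?w)
      + (?i (y 1 1 + x 1 1 + ?w) - ?i (y 1 1 + x 1 1) - ?i ?w)
      + (?i (y 1 1 + x 1 1) - ?i (y 1 1) - ?i (x 1 1))
      - (?i (a 1 1 + b 1 1) - ?i (a 1 1) - ?i (b 1 1)) \<in> J"
    by (rule env.J_diff[OF env.J_add[OF env.J_add[OF env.J_diff[OF 1 env.inc_bracket] env.inc_add] env.inc_add] env.inc_add])
  then have "?i (y 1 1 + x 1 1 + ?w) - ?i (a 1 1 + b 1 1) \<in> J" by (simp add: algebra_simps)
  then show ?thesis using env.inc_eqI by metis
qed

lemma factorization_lowest_order:
  assumes \<Psi>: "is_factorization_bijection scale bracket gm gp \<Psi>"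
    and f: "g_plus \<in> series gp" and h: "g_minus \<in> series gm"
  shows "\<exists>\<Psi>_minus\<in>series gm. \<exists>\<Psi>_plus\<in>series gp. \<exists>P_minus\<in>series gm. \<exists>P_plus\<in>series gp.
          mul_s \<Psi>_minus = pi_minus gm gp (pair_sum (\<Psi> (mul_t g_plus, mul_s g_minus))) \<and>
          mul_t \<Psi>_plus = pi_plus gm gp (pair_sum (\<Psi> (mul_t g_plus, mul_s g_minus))) \<and>
          \<Psi>_minus = g_minus + mul_t (pi_minus gm gp (series_bracket bracket g_plus g_minus))
            + mul_t P_minus \<and>
          \<Psi>_plus = g_plus + mul_s (pi_plus gm gp (series_bracket bracket g_plus g_minus))
            + mul_s P_plus \<and>
          P_minus 0 0 = 0 \<and> P_plus 0 0 = 0"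
proof -
  define x where "x = mul_t g_plus"
  define y where "y = mul_s g_minus"
  have xy: "x \<in> families plus_coeffs" "y \<in> families minus_coeffs"
    using f h unfolding x_def y_def mul_t_image[symmetric] mul_s_image[symmetric] by blast+
  obtain a b where ab: "a \<in> families minus_coeffs" "b \<in> families plus_coeffs" and cong: "exp_cong (x, y) (a, b)"
    and ax: "\<And>i j. i = 0 \<or> j = 0 \<Longrightarrow> a i j = y i j \<and> b i j = x i j"
    using exp_refactor_families(2)[of minus_coeffs plus_coeffs x y] xy by auto
  have ex1: "\<exists>!q. q \<in> families minus_coeffs \<times> families plus_coeffs \<and> exp_cong (x, y) q"
    by (rule exp_refactor_families(1)) (simp_all add: xy)
  have q: "(a, b) \<in> families minus_coeffs \<times> families plus_coeffs \<and> exp_cong (x, y) (a, b)" using ab cong by simp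
  have "\<Psi> (x, y) \<in> families minus_coeffs \<times> families plus_coeffs \<and> exp_cong (x, y) (\<Psi> (x, y))"
    using \<Psi> xy bij_betw_apply[of \<Psi> "families plus_coeffs \<times> families minus_coeffs" "families minus_coeffs \<times> families plus_coeffs" "(x, y)"]
    unfolding is_factorization_bijection_iff by blast
  from the1_equality[OF ex1 q] the1_equality[OF ex1 this] have \<Psi>xy: "\<Psi> (x, y) = (a, b)" by simp
  have pi: "pi_minus gm gp (pair_sum (\<Psi> (x, y))) = a" "pi_plus gm gp (pair_sum (\<Psi> (x, y))) = b"
    using pi_pair_sum[of "(a, b)"] ab by (simp_all add: \<Psi>xy)
  let ?br = "series_bracket bracket g_plus g_minus"
  have proj: "proj_along gm gp z \<in> gm" "proj_along gp gm z \<in> gp"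
    "proj_along gm gp z + proj_along gp gm z = z" for z
    using decomp_sum[of z] by (auto simp: proj_minus proj_plus)
  obtain \<Psi>m where \<Psi>m: "\<Psi>m \<in> series gm" "a = mul_s \<Psi>m" using ab(1) unfolding mul_s_image[symmetric] by blast
  obtain \<Psi>p where \<Psi>p: "\<Psi>p \<in> series gp" "b = mul_t \<Psi>p" using ab(2) unfolding mul_t_image[symmetric] by blast
  \<comment> \<open>The remainders are obtained by solving the two formulas for them. What has to be
    checked is that \<open>\<Psi>m\<close> and \<open>g_minus\<close> agree where the exponent of
    \<open>t\<close> is 0, and \<open>\<Psi>p\<close> and \<open>g_plus\<close> where that of
    \<open>s\<close> is 0; these are the axis values.\<close>
  define Pm where "Pm = (\<lambda>i j. \<Psi>m i (Suc j) - g_minus i (Suc j) - pi_minus gm gp ?br i j)"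
  define Pp where "Pp = (\<lambda>i j. \<Psi>p (Suc i) j - g_plus (Suc i) j - pi_plus gm gp ?br i j)"
  have memP: "Pm \<in> series gm" "Pp \<in> series gp"
    using \<Psi>m(1) \<Psi>p(1) f h proj subspace_diff[OF subspace_minus] subspace_diff[OF subspace_plus]
    by (simp_all add: series_def Pm_def Pp_def pi_minus_def pi_plus_def map_series_def)
  have "\<Psi>m i 0 = g_minus i 0" for i
    using ax[of "Suc i" 0] by (simp add: \<Psi>m(2) y_def mul_s_def)
  then have em: "\<Psi>m = g_minus + mul_t (pi_minus gm gp ?br) + mul_t Pm"
    by (auto simp: fun_eq_iff mul_t_def Pm_def split: nat.split)
  have "\<Psi>p 0 j = g_plus 0 j" for j
    using ax[of 0 "Suc j"] by (simp add: \<Psi>p(2) x_def mul_t_def)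
  then have ep: "\<Psi>p = g_plus + mul_s (pi_plus gm gp ?br) + mul_s Pp"
    by (auto simp: fun_eq_iff mul_s_def Pp_def split: nat.split)
  have "a 1 1 + b 1 1 = y 1 1 + x 1 1 + bracket (x 0 1) (y 1 0)"
    by (rule factor_coeff_1_1[OF xy ab cong]) (use ax in simp_all)
  then have "\<Psi>m 0 1 + \<Psi>p 1 0 = g_minus 0 1 + g_plus 1 0 + ?br 0 0"
    by (simp add: \<Psi>m(2) \<Psi>p(2) x_def y_def mul_s_def mul_t_def series_bracket_def)
  \<comment> \<open>The coefficient of \<open>s t\<close> determines only the sum of the two
    constant terms; as the decomposition is direct, each of them vanishes.\<close>
  then have "Pm 0 0 + Pp 0 0 = 0"
    using proj(3)[of "?br 0 0"]
    by (simp add: Pm_def Pp_def pi_minus_def pi_plus_def map_series_def algebra_simps)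
  moreover have "Pm 0 0 \<in> gm" "Pp 0 0 \<in> gp" using memP by (simp_all add: series_def)
  ultimately have P0: "Pm 0 0 = 0" "Pp 0 0 = 0"
    using proj_minus[of "Pm 0 0" "Pp 0 0"] proj_plus[of "Pm 0 0" "Pp 0 0"]
      proj_minus[of 0 0] proj_plus[of 0 0] zero_minus zero_plus by simp_all
  show ?thesis
    using \<Psi>m(1) \<Psi>p(1) memP em ep P0 pi \<Psi>m(2) \<Psi>p(2) unfolding x_def y_def by metis
qed

end

theorem corollary3p12:
  fixes scale :: "'k::field_char_0 \<Rightarrow> 'g::ab_group_add \<Rightarrow> 'g"
    and bracket :: "'g \<Rightarrow> 'g \<Rightarrow> 'g"
    and gm gp :: "'g set"
  assumes "split_lie_algebra scale bracket gm gp"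
  shows "(\<exists>!\<Psi>. is_factorization_bijection scale bracket gm gp \<Psi>) \<and>
    (\<forall>\<Psi>. is_factorization_bijection scale bracket gm gp \<Psi> \<longrightarrow>
      (\<forall>g_plus\<in>series gp. \<forall>g_minus\<in>series gm.
        \<exists>\<Psi>_minus\<in>series gm. \<exists>\<Psi>_plus\<in>series gp. \<exists>P_minus\<in>series gm. \<exists>P_plus\<in>series gp.
          mul_s \<Psi>_minus = pi_minus gm gp (pair_sum (\<Psi> (mul_t g_plus, mul_s g_minus))) \<and>
          mul_t \<Psi>_plus = pi_plus gm gp (pair_sum (\<Psi> (mul_t g_plus, mul_s g_minus))) \<and>
          \<Psi>_minus = g_minus + mul_t (pi_minus gm gp (series_bracket bracket g_plus g_minus))
            + mul_t P_minus \<and>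
          \<Psi>_plus = g_plus + mul_s (pi_plus gm gp (series_bracket bracket g_plus g_minus))
            + mul_s P_plus \<and>
          P_minus 0 0 = 0 \<and> P_plus 0 0 = 0))"
proof -
  interpret split_lie_algebra_char_0 scale bracket gm gp
    using assms by (rule split_lie_algebra_char_0.intro)
  show ?thesis
    using ex1_factorization_bijection factorization_lowest_order by blast
qed

end
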